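(* There exists an algorithm that, given as input a graph $H$, a graph $G$ on $n$ vertices, and a weight function $w : V(G) \rightarrow \mathbb{N}$, together with access to oracles $O_{H_i}$ for every connected component $H_i$ of $H$, outputs the weight of a maximum weight independent set of $G$. If $G$ is $H$-free, then the algorithm uses at most $n^{O(|H|^2 \, |\mathcal{CC}(H)| \, \log^3 n)}$ operations and oracle calls, where all oracle calls are made on induced subgraphs of $G$.
   Context: All graphs are finite, simple and undirected. A graph $G$ is $H$-free if it contains no induced subgraph isomorphic to $H$. $\mathcal{CC}(H)$ denotes the set of connected components of $H$ and $|H|$ the number of vertices of $H$. For a graph $F$, the oracle $O_F$ takes as input an $F$-free graph (with vertex weights) and outputs the weight of a maximum weight independent set in it, where the weight of a set is the sum of the weights of its vertices. Arithmetic operations on weights are assumed to take constant time. *)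

theory Defs
  imports Complex_Main
begin

datatype 'a graph = Graph (verts: "'a set") (edges: "'a set set")

definition simple_graph :: "'a graph \<Rightarrow> bool" where
  "simple_graph G \<longleftrightarrow> finite (verts G) \<and> (\<forall>e \<in> edges G. e \<subseteq> verts G \<and> card e = 2)"

definition induced :: "'a graph \<Rightarrow> 'a set \<Rightarrow> 'a graph" where
  "induced G S = Graph S {e \<in> edges G. e \<subseteq> S}"

definition isomorphic :: "'a graph \<Rightarrow> 'b graph \<Rightarrow> bool" where
  "isomorphic G H \<longleftrightarrow> (\<exists>f. bij_betw f (verts G) (verts H) \<and>
     (\<forall>u \<in> verts G. \<forall>v \<in> verts G. {u, v} \<in> edges G \<longleftrightarrow> {f u, f v} \<in> edges H))"

definition is_free :: "'b graph \<Rightarrow> 'a graph \<Rightarrow> bool" where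
  "is_free H G \<longleftrightarrow> \<not> (\<exists>S \<subseteq> verts G. isomorphic (induced G S) H)"

definition adj_rel :: "'a graph \<Rightarrow> ('a \<times> 'a) set" where
  "adj_rel G = {(u, v). {u, v} \<in> edges G}"

text \<open>Isomorphic components on different vertex sets are different elements.\<close>

definition components :: "'a graph \<Rightarrow> 'a graph set" where
  "components G = {induced G {u. (v, u) \<in> (adj_rel G)\<^sup>*} | v. v \<in> verts G}"

definition independent :: "'a graph \<Rightarrow> 'a set \<Rightarrow> bool" where
  "independent G I \<longleftrightarrow> I \<subseteq> verts G \<and> (\<forall>u \<in> I. \<forall>v \<in> I. {u, v} \<notin> edges G)"

definition mwis :: "'a graph \<Rightarrow> ('a \<Rightarrow> nat) \<Rightarrow> nat" where
  "mwis G w = Max {(\<Sum>v \<in> I. w v) | I. independent G I}"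

text \<open>
  Algorithms are programs of a first-order, call-by-value functional language
  over binary trees with natural numbers at the leaves.  A program is a finite list
  of function bodies; a body is evaluated in the environment of its arguments
  (de Bruijn indices), and function 0 is the entry point.  Every evaluated node of
  an expression costs one operation.

  The primitives are chosen so that each of them takes constant time on a unit-cost
  random access machine: trees are pointers (no structural equality test), and the
  arithmetic consists of addition, truncated subtraction and comparison of numbers.
  There is no unit-cost multiplication, which on unbounded numbers would be too
  powerful.  A running time bound in this model therefore carries over to the
  random access machine up to a constant factor.  Evaluation is stuck on ill-typed
  operations.
\<close>

datatype val = Num nat | Node val val

datatype expr =
    Var nat
  | Const nat
  | Add expr expr
  | Sub expr expr
  | Less expr expr
  | MkNode expr expr
  | Fst expr
  | Snd expr
  | IsNum expr
  | IfNonzero expr expr expr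
  | Bind expr expr
  | Call nat "expr list"
  | Query expr expr

type_synonym program = "expr list"

text \<open>
  \<open>runs Q P env e v t qs\<close>: in the program \<open>P\<close>, the expression \<open>e\<close> evaluates to \<open>v\<close> in
  the environment \<open>env\<close> with \<open>t\<close> operations and oracle calls in total, and \<open>qs\<close> is the
  set of all oracle calls made.  An oracle call has two arguments: a description of a graph
  \<open>F\<close>, which selects the oracle, and the input to that oracle.  Answers of \<open>Q\<close> on
  arguments outside of the domain of the oracles are arbitrary.
\<close>

inductive runs :: "(val \<Rightarrow> val \<Rightarrow> nat) \<Rightarrow> program \<Rightarrow> val list \<Rightarrow> expr \<Rightarrow> val \<Rightarrow> nat
    \<Rightarrow> (val \<times> val) set \<Rightarrow> bool"
  and runs_list :: "(val \<Rightarrow> val \<Rightarrow> nat) \<Rightarrow> program \<Rightarrow> val list \<Rightarrow> expr list \<Rightarrow> val list \<Rightarrow> nat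
    \<Rightarrow> (val \<times> val) set \<Rightarrow> bool"
  for Q P where
  Var: "i < length env \<Longrightarrow> runs Q P env (Var i) (env ! i) 1 {}"
| Const: "runs Q P env (Const k) (Num k) 1 {}"
| Add: "runs Q P env a (Num m) s p \<Longrightarrow> runs Q P env b (Num n) t q \<Longrightarrow>
    runs Q P env (Add a b) (Num (m + n)) (s + t + 1) (p \<union> q)"
| Sub: "runs Q P env a (Num m) s p \<Longrightarrow> runs Q P env b (Num n) t q \<Longrightarrow>
    runs Q P env (Sub a b) (Num (m - n)) (s + t + 1) (p \<union> q)"
| Less: "runs Q P env a (Num m) s p \<Longrightarrow> runs Q P env b (Num n) t q \<Longrightarrow>
    runs Q P env (Less a b) (Num (if m < n then 1 else 0)) (s + t + 1) (p \<union> q)"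
| MkNode: "runs Q P env a x s p \<Longrightarrow> runs Q P env b y t q \<Longrightarrow>
    runs Q P env (MkNode a b) (Node x y) (s + t + 1) (p \<union> q)"
| Fst: "runs Q P env a (Node x y) t q \<Longrightarrow> runs Q P env (Fst a) x (t + 1) q"
| Snd: "runs Q P env a (Node x y) t q \<Longrightarrow> runs Q P env (Snd a) y (t + 1) q"
| IsNum_Num: "runs Q P env a (Num k) t q \<Longrightarrow> runs Q P env (IsNum a) (Num 1) (t + 1) q"
| IsNum_Node: "runs Q P env a (Node x y) t q \<Longrightarrow> runs Q P env (IsNum a) (Num 0) (t + 1) q"
| If_nonzero: "runs Q P env c (Num k) s p \<Longrightarrow> k \<noteq> 0 \<Longrightarrow> runs Q P env a v t q \<Longrightarrow>
    runs Q P env (IfNonzero c a b) v (s + t + 1) (p \<union> q)"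
| If_zero: "runs Q P env c (Num 0) s p \<Longrightarrow> runs Q P env b v t q \<Longrightarrow>
    runs Q P env (IfNonzero c a b) v (s + t + 1) (p \<union> q)"
| Bind: "runs Q P env a x s p \<Longrightarrow> runs Q P (x # env) b v t q \<Longrightarrow>
    runs Q P env (Bind a b) v (s + t + 1) (p \<union> q)"
| Call: "runs_list Q P env as xs s p \<Longrightarrow> f < length P \<Longrightarrow> runs Q P xs (P ! f) v t q \<Longrightarrow>
    runs Q P env (Call f as) v (s + t + 1) (p \<union> q)"
| Query: "runs Q P env a x s p \<Longrightarrow> runs Q P env b y t q \<Longrightarrow>
    runs Q P env (Query a b) (Num (Q x y)) (s + t + 1) (insert (x, y) (p \<union> q))"
| Nil: "runs_list Q P env [] [] 0 {}"
| Cons: "runs Q P env a x s p \<Longrightarrow> runs_list Q P env as xs t q \<Longrightarrow>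
    runs_list Q P env (a # as) (x # xs) (s + t) (p \<union> q)"

definition run_program :: "(val \<Rightarrow> val \<Rightarrow> nat) \<Rightarrow> program \<Rightarrow> val list \<Rightarrow> val \<Rightarrow> nat
    \<Rightarrow> (val \<times> val) set \<Rightarrow> bool" where
  "run_program Q P inputs v t qs \<longleftrightarrow> P \<noteq> [] \<and> runs Q P inputs (P ! 0) v t qs"

text \<open>Evaluation is deterministic, so that the result, the cost and the oracle calls of a run
  are well defined.\<close>

inductive_cases runs_elims:
  "runs Q P env (Var i) v t q" "runs Q P env (Const k) v t q" "runs Q P env (Add a b) v t q"
  "runs Q P env (Sub a b) v t q" "runs Q P env (Less a b) v t q" "runs Q P env (MkNode a b) v t q"
  "runs Q P env (Fst a) v t q" "runs Q P env (Snd a) v t q" "runs Q P env (IsNum a) v t q"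
  "runs Q P env (IfNonzero c a b) v t q" "runs Q P env (Bind a b) v t q"
  "runs Q P env (Call f as) v t q" "runs Q P env (Query a b) v t q"
  "runs_list Q P env [] vs t q" "runs_list Q P env (a # as) vs t q"

lemma runs_deterministic:
  "runs Q P env e v t q \<Longrightarrow> runs Q P env e v' t' q' \<Longrightarrow> v' = v \<and> t' = t \<and> q' = q"
  "runs_list Q P env es vs t q \<Longrightarrow> runs_list Q P env es vs' t' q' \<Longrightarrow> vs' = vs \<and> t' = t \<and> q' = q"
proof (induction arbitrary: v' t' q' and vs' t' q' rule: runs_runs_list.inducts)
  case Var
  from Var.prems show ?case
    by (rule runs_elims) simp_all
next
  case Const
  from Const.prems show ?case
    by (rule runs_elims) simp_all
next
  case Add
  from Add.prems show ?case
    by (rule runs_elims) (auto dest!: Add.IH(2) Add.IH(4))+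
next
  case Sub
  from Sub.prems show ?case
    by (rule runs_elims) (auto dest!: Sub.IH(2) Sub.IH(4))+
next
  case Less
  from Less.prems show ?case
    by (rule runs_elims) (auto dest!: Less.IH(2) Less.IH(4))+
next
  case MkNode
  from MkNode.prems show ?case
    by (rule runs_elims) (auto dest!: MkNode.IH(2) MkNode.IH(4))+
next
  case Fst
  from Fst.prems show ?case
    by (rule runs_elims) (auto dest!: Fst.IH(2))+
next
  case Snd
  from Snd.prems show ?case
    by (rule runs_elims) (auto dest!: Snd.IH(2))+
next
  case IsNum_Num
  from IsNum_Num.prems show ?case
    by (rule runs_elims) (auto dest!: IsNum_Num.IH(2))+
next
  case IsNum_Node
  from IsNum_Node.prems show ?case
    by (rule runs_elims) (auto dest!: IsNum_Node.IH(2))+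
next
  case If_nonzero
  from If_nonzero.prems show ?case
    by (rule runs_elims) (use If_nonzero.hyps in \<open>auto dest!: If_nonzero.IH(2) If_nonzero.IH(4)\<close>)+
next
  case If_zero
  from If_zero.prems show ?case
    by (rule runs_elims) (auto dest!: If_zero.IH(2) If_zero.IH(4))+
next
  case Bind
  from Bind.prems show ?case
    by (rule runs_elims) (auto dest!: Bind.IH(2) Bind.IH(4))+
next
  case Call
  from Call.prems show ?case
    by (rule runs_elims) (auto dest!: Call.IH(2) Call.IH(5))+
next
  case Query
  from Query.prems show ?case
    by (rule runs_elims) (auto dest!: Query.IH(2) Query.IH(4))+
next
  case Nil
  from Nil.prems show ?case
    by (rule runs_elims) simp_all
next
  case Cons
  from Cons.prems show ?case
    by (rule runs_elims) (auto dest!: Cons.IH(2) Cons.IH(4))+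
qed

text \<open>Graphs are given by adjacency lists, with vertices listed in increasing order.\<close>

fun enc_list :: "val list \<Rightarrow> val" where
  "enc_list [] = Num 0"
| "enc_list (x # xs) = Node x (enc_list xs)"

definition enc_nbrs :: "nat graph \<Rightarrow> nat \<Rightarrow> val" where
  "enc_nbrs G u = enc_list (map Num (sorted_list_of_set {v \<in> verts G. {u, v} \<in> edges G}))"

definition enc_graph :: "nat graph \<Rightarrow> val" where
  "enc_graph G = enc_list (map (\<lambda>u. Node (Num u) (enc_nbrs G u)) (sorted_list_of_set (verts G)))"

definition enc_wgraph :: "nat graph \<Rightarrow> (nat \<Rightarrow> nat) \<Rightarrow> val" where
  "enc_wgraph G w = enc_list (map (\<lambda>u. Node (Num u) (Node (Num (w u)) (enc_nbrs G u)))
     (sorted_list_of_set (verts G)))"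

definition solves_mwis_free :: "nat graph \<Rightarrow> (val \<Rightarrow> nat) \<Rightarrow> bool" where
  "solves_mwis_free F f \<longleftrightarrow>
     (\<forall>G w. simple_graph G \<and> is_free F G \<longrightarrow> f (enc_wgraph G w) = mwis G w)"

text \<open>Such a function exists for every \<open>F\<close>, because the encoding determines the weighted graph.\<close>

lemma enc_list_inject: "enc_list xs = enc_list ys \<Longrightarrow> xs = ys"
  by (induction xs arbitrary: ys) (case_tac ys; simp)+

lemma enc_wgraph_inject:
  assumes G: "simple_graph G" "simple_graph G'" and eq: "enc_wgraph G w = enc_wgraph G' w'"
  shows "G = G'" and "\<And>v. v \<in> verts G \<Longrightarrow> w v = w' v"
proof -
  let ?f = "\<lambda>G w u. Node (Num u) (Node (Num (w u)) (enc_nbrs G u))"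
  let ?name = "\<lambda>x. case x of Node (Num u) _ \<Rightarrow> u | _ \<Rightarrow> 0"
  let ?vs = "\<lambda>G. sorted_list_of_set (verts G)"
  have fin: "finite (verts G)" "finite (verts G')"
    using G by (auto simp: simple_graph_def)
  have maps: "map (?f G w) (?vs G) = map (?f G' w') (?vs G')"
    using eq enc_list_inject unfolding enc_wgraph_def by blast
  then have "map ?name (map (?f G w) (?vs G)) = map ?name (map (?f G' w') (?vs G'))"
    by simp
  then have vs: "?vs G = ?vs G'"
    by (simp add: comp_def)
  then have verts: "verts G = verts G'"
    using fin by (intro sorted_list_of_set_inject)
  have node: "?f G w u = ?f G' w' u" if "u \<in> verts G" for u
    using maps that fin unfolding vs verts by (simp add: map_eq_conv)
  then show "\<And>v. v \<in> verts G \<Longrightarrow> w v = w' v"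
    by simp
  have nbrs: "{v \<in> verts G. {u, v} \<in> edges G} = {v \<in> verts G'. {u, v} \<in> edges G'}"
    if u: "u \<in> verts G" for u
  proof -
    have "map Num (sorted_list_of_set {v \<in> verts G. {u, v} \<in> edges G}) =
        map Num (sorted_list_of_set {v \<in> verts G'. {u, v} \<in> edges G'})"
      using node[OF u] enc_list_inject unfolding enc_nbrs_def by blast
    then have "sorted_list_of_set {v \<in> verts G. {u, v} \<in> edges G} =
        sorted_list_of_set {v \<in> verts G'. {u, v} \<in> edges G'}"
      by (rule map_injective) (rule injI, simp)
    then show ?thesis
      by (rule sorted_list_of_set_inject) (use fin in simp_all)
  qed
  have sub: "edges A \<subseteq> edges B"
    if "simple_graph A" "verts A = verts B"
      and "\<And>u. u \<in> verts A \<Longrightarrow> {v \<in> verts A. {u, v} \<in> edges A} = {v \<in> verts B. {u, v} \<in> edges B}"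
    for A B :: "nat graph"
  proof
    fix e assume e: "e \<in> edges A"
    with that(1) have "card e = 2" "e \<subseteq> verts A"
      by (simp_all add: simple_graph_def)
    then obtain u v where uv: "e = {u, v}" "u \<in> verts A" "v \<in> verts A"
      by (auto simp: card_2_iff)
    then have "v \<in> {v \<in> verts A. {u, v} \<in> edges A}"
      using e by simp
    then have "v \<in> {v \<in> verts B. {u, v} \<in> edges B}"
      using that(3)[OF uv(2)] by simp
    then show "e \<in> edges B"
      using uv(1) by simp
  qed
  have "edges G = edges G'"
  proof (rule equalityI)
    show "edges G \<subseteq> edges G'"
      using G(1) verts nbrs by (rule sub)
    show "edges G' \<subseteq> edges G"
      by (rule sub[OF G(2) verts[symmetric]]) (use nbrs verts in simp)
  qed
  with verts show "G = G'"
    by (simp add: graph.expand)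
qed

lemma mwis_cong: "(\<And>v. v \<in> verts G \<Longrightarrow> w v = w' v) \<Longrightarrow> mwis G w = mwis G w'"
proof -
  assume w: "\<And>v. v \<in> verts G \<Longrightarrow> w v = w' v"
  have "(\<Sum>v \<in> I. w v) = (\<Sum>v \<in> I. w' v)" if "independent G I" for I
    using that w by (intro sum.cong) (auto simp: independent_def)
  then have "((\<lambda>I. \<Sum>v \<in> I. w v) ` {I. independent G I}) = ((\<lambda>I. \<Sum>v \<in> I. w' v) ` {I. independent G I})"
    by (intro image_cong) simp_all
  then show ?thesis
    by (simp add: mwis_def setcompr_eq_image)
qed

lemma solves_mwis_free_exists: "\<exists>f. solves_mwis_free F f"
proof -
  define f where "f x = (SOME k. \<exists>G w. simple_graph G \<and> x = enc_wgraph G w \<and> k = mwis G w)" for x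
  have "f (enc_wgraph G w) = mwis G w" if "simple_graph G" for G w
    unfolding f_def
  proof (rule some_equality)
    show "\<exists>G' w'. simple_graph G' \<and> enc_wgraph G w = enc_wgraph G' w' \<and> mwis G w = mwis G' w'"
      using that by blast
    fix k assume "\<exists>G' w'. simple_graph G' \<and> enc_wgraph G w = enc_wgraph G' w' \<and> k = mwis G' w'"
    then obtain G' w' where k: "simple_graph G'" "enc_wgraph G w = enc_wgraph G' w'" "k = mwis G' w'"
      by blast
    then show "k = mwis G w"
      using enc_wgraph_inject[OF that k(1,2)] mwis_cong[of G w w'] by metis
  qed
  then show ?thesis
    unfolding solves_mwis_free_def by blast
qed

end

theory Submission
  imports Defs
begin

text \<open>
  Let \<open>C\<close> be a component of the pattern \<open>H\<close> and \<open>D\<close> the union of the others.  If \<open>C\<close> does not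
  embed into \<open>G\<close>, the oracle for \<open>C\<close> is asked; if \<open>D\<close> does not embed, one continues with the smaller
  pattern \<open>D\<close>.  Otherwise one branches on whether a vertex \<open>x\<close> belongs to the solution, where \<open>x\<close> is
  chosen such that \<open>G - N[x]\<close> has as few copies of \<open>D\<close> as possible.  If \<open>G\<close> is \<open>H\<close>-free, every copy of
  \<open>D\<close> meets the closed neighbourhood of a fixed copy of \<open>C\<close>, so that taking \<open>x\<close> destroys at least a
  fraction \<open>1/|C|\<close> of the at most \<open>n ^ |D|\<close> copies of \<open>D\<close>.  Hence a path of the recursion takes
  \<open>O(|C| |D| log n)\<close> vertices for this \<open>C\<close> and \<open>O(|H|\<^sup>2 log n)\<close> vertices in total, and the recursion
  tree has \<open>n\<close> to the power \<open>O(|H|\<^sup>2 log n)\<close> nodes.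
\<close>

section \<open>A calculus for running times\<close>

text \<open>The output must be right for every \<open>G\<close>, the time only for
  \<open>H\<close>-free ones. So the value rests on the branching rule, valid for any vertex
  \<open>x\<close>, and on oracle calls guarded by an explicit test that the component does not
  embed; being \<open>H\<close>-free serves only to show that a good \<open>x\<close> exists. The
  averaging argument starts from an arbitrary copy of \<open>C\<close>; the program need not find
  that copy, since trying all vertices and counting exactly yields an \<open>x\<close> at least as
  good. Counting takes n to the power |H| + O(1), which the claimed bound absorbs.

  Let p bound the vertices still to be taken. Branching on m vertices gives T(m, p) <= K + T(m - 1,
  p) + T(m - 1, p - 1), which is solved by a power of m + 1 with exponent about p. This exponent
  splits into a budget for the current \<open>D\<close> and a reserve for the later patterns.
  Discarding \<open>x\<close> costs no budget, because deleting vertices never increases the number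
  of copies.\<close>

definition SOLVE :: nat where "SOLVE = 0"
definition MEM :: nat where "MEM = 1"
definition DIFF :: nat where "DIFF = 2"
definition DELETE :: nat where "DELETE = 3"
definition COMPAT :: nat where "COMPAT = 4"
definition COUNT :: nat where "COUNT = 5"
definition COUNTDEL :: nat where "COUNTDEL = 6"
definition BEST :: nat where "BEST = 7"
definition TOUCH :: nat where "TOUCH = 8"
definition EXPAND :: nat where "EXPAND = 9"
definition REACH :: nat where "REACH = 10"
definition KEEP :: nat where "KEEP = 11"
definition DROP :: nat where "DROP = 12"
definition BRANCH :: nat where "BRANCH = 13"

lemmas fname_defs = SOLVE_def MEM_def DIFF_def DELETE_def COMPAT_def COUNT_def COUNTDEL_def
  BEST_def TOUCH_def EXPAND_def REACH_def KEEP_def DROP_def BRANCH_def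

text \<open>Lists end in a number, so \<open>IsNum\<close> tests for the empty list. Numbers are
  compared by \<open>Less\<close> alone: two of them differ iff the sum of both comparisons is
  nonzero.\<close>

definition mem_body :: expr where
  "mem_body = IfNonzero (IsNum (Var 1)) (Const 0)
     (IfNonzero (Add (Less (Var 0) (Fst (Var 1))) (Less (Fst (Var 1)) (Var 0)))
       (Call MEM [Var 0, Snd (Var 1)]) (Const 1))"

definition diff_body :: expr where
  "diff_body = IfNonzero (IsNum (Var 0)) (Const 0)
     (IfNonzero (Call MEM [Fst (Var 0), Var 1]) (Call DIFF [Snd (Var 0), Var 1])
       (MkNode (Fst (Var 0)) (Call DIFF [Snd (Var 0), Var 1])))"

definition delete_body :: expr where
  "delete_body = IfNonzero (IsNum (Var 0)) (Const 0)
     (IfNonzero (Call MEM [Fst (Fst (Var 0)), Var 1]) (Call DELETE [Snd (Var 0), Var 1])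
       (MkNode
         (MkNode (Fst (Fst (Var 0)))
           (MkNode (Fst (Snd (Fst (Var 0)))) (Call DIFF [Snd (Snd (Fst (Var 0))), Var 1])))
         (Call DELETE [Snd (Var 0), Var 1])))"

text \<open>Arguments: partial embedding as a list of pairs, neighbours of the new vertex, its image,
  neighbours of the image.\<close>
definition compat_body :: expr where
  "compat_body = IfNonzero (IsNum (Var 0)) (Const 1)
     (IfNonzero
       (IfNonzero (Add (Less (Snd (Fst (Var 0))) (Var 2)) (Less (Var 2) (Snd (Fst (Var 0)))))
         (IfNonzero (Call MEM [Fst (Fst (Var 0)), Var 1])
           (Call MEM [Snd (Fst (Var 0)), Var 3])
           (Sub (Const 1) (Call MEM [Snd (Fst (Var 0)), Var 3])))
         (Const 0))
       (Call COMPAT [Snd (Var 0), Var 1, Var 2, Var 3])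
       (Const 0))"

text \<open>Arguments: vertices still to be mapped, partial embedding, weighted graph, vertices of it
  that are still to be tried as the image of the first vertex.\<close>
definition count_body :: expr where
  "count_body = IfNonzero (IsNum (Var 0)) (Const 1) (IfNonzero (IsNum (Var 3)) (Const 0)
     (Add
       (IfNonzero
         (Call COMPAT [Var 1, Snd (Fst (Var 0)), Fst (Fst (Var 3)), Snd (Snd (Fst (Var 3)))])
         (Call COUNT
           [Snd (Var 0), MkNode (MkNode (Fst (Fst (Var 0))) (Fst (Fst (Var 3)))) (Var 1), Var 2, Var 2])
         (Const 0))
       (Call COUNT [Var 0, Var 1, Var 2, Snd (Var 3)])))"

text \<open>Arguments: pattern, weighted graph, vertex of it whose closed neighbourhood is deleted.\<close>
definition countdel_body :: expr where
  "countdel_body =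
     Bind (Call DELETE [Var 1, MkNode (Fst (Var 2)) (Snd (Snd (Var 2)))])
       (Call COUNT [Var 1, Const 0, Var 0, Var 0])"

text \<open>Arguments: pattern, weighted graph, nonempty list of candidates.\<close>
definition best_body :: expr where
  "best_body = IfNonzero (IsNum (Snd (Var 2)))
     (MkNode (Call COUNTDEL [Var 0, Var 1, Fst (Var 2)]) (Fst (Var 2)))
     (Bind (Call BEST [Var 0, Var 1, Snd (Var 2)])
       (Bind (Call COUNTDEL [Var 1, Var 2, Fst (Var 3)])
         (IfNonzero (Less (Var 0) (Fst (Var 1))) (MkNode (Var 0) (Fst (Var 4))) (Var 1))))"

definition touch_body :: expr where
  "touch_body = IfNonzero (IsNum (Var 0)) (Const 0)
     (IfNonzero (Call MEM [Fst (Var 0), Var 1]) (Const 1) (Call TOUCH [Snd (Var 0), Var 1]))"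

definition expand_body :: expr where
  "expand_body = IfNonzero (IsNum (Var 0)) (Const 0)
     (IfNonzero (Call TOUCH [Fst (Var 0), Var 1])
       (MkNode (Fst (Fst (Var 0))) (Call EXPAND [Snd (Var 0), Var 1]))
       (Call EXPAND [Snd (Var 0), Var 1]))"

text \<open>Arguments: list whose length is the number of rounds, graph, set of vertices.\<close>
definition reach_body :: expr where
  "reach_body = IfNonzero (IsNum (Var 0)) (Var 2)
     (Call REACH [Snd (Var 0), Var 1, Call EXPAND [Var 1, Var 2]])"

definition keep_body :: expr where
  "keep_body = IfNonzero (IsNum (Var 0)) (Const 0)
     (IfNonzero (Call MEM [Fst (Fst (Var 0)), Var 1])
       (MkNode (Fst (Var 0)) (Call KEEP [Snd (Var 0), Var 1]))
       (Call KEEP [Snd (Var 0), Var 1]))"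

definition drop_body :: expr where
  "drop_body = IfNonzero (IsNum (Var 0)) (Const 0)
     (IfNonzero (Call MEM [Fst (Fst (Var 0)), Var 1])
       (Call DROP [Snd (Var 0), Var 1])
       (MkNode (Fst (Var 0)) (Call DROP [Snd (Var 0), Var 1])))"

text \<open>Arguments: pattern, weighted graph, entry of the branching vertex. The entry contains
  the neighbours, so the closed neighbourhood is listed by adding one node. Each \<open>Bind\<close>
  shifts the indices of the arguments by one.\<close>

definition branch_body :: expr where
  "branch_body =
     Bind (Call SOLVE [Var 0, Call DELETE [Var 1, MkNode (Fst (Var 2)) (Const 0)]])
       (Bind (Add (Fst (Snd (Var 3)))
           (Call SOLVE [Var 1, Call DELETE [Var 2, MkNode (Fst (Var 3)) (Snd (Snd (Var 3)))]]))
         (IfNonzero (Less (Var 1) (Var 0)) (Var 0) (Var 1)))"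

text \<open>Evaluated below the three binders of \<open>solve_body\<close>: the pattern is \<open>Var 3\<close>, the weighted graph
  \<open>Var 4\<close>, the first component of the pattern \<open>Var 1\<close> and the rest of the pattern \<open>Var 0\<close>.\<close>
definition dispatch_body :: expr where
  "dispatch_body = IfNonzero (Call COUNT [Var 1, Const 0, Var 4, Var 4])
     (IfNonzero (Call COUNT [Var 0, Const 0, Var 4, Var 4])
       (Call BRANCH [Var 3, Var 4, Snd (Call BEST [Var 0, Var 4, Var 4])])
       (Call SOLVE [Var 0, Var 4]))
     (Query (Var 1) (Var 4))"

text \<open>An empty graph is answered first, which makes \<open>Fst (Var 1)\<close> safe. An empty
  pattern has no component and hence no oracle; as it embeds into every graph, no time bound is owed
  and branching on the first vertex is enough.\<close>

definition solve_body :: expr where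
  "solve_body = IfNonzero (IsNum (Var 1)) (Const 0)
     (IfNonzero (IsNum (Var 0)) (Call BRANCH [Var 0, Var 1, Fst (Var 1)])
       (Bind (Call REACH [Var 0, Var 0, MkNode (Fst (Fst (Var 0))) (Const 0)])
         (Bind (Call KEEP [Var 1, Var 0]) (Bind (Call DROP [Var 2, Var 1]) dispatch_body))))"

definition prog :: program where
  "prog = [solve_body, mem_body, diff_body, delete_body, compat_body, count_body, countdel_body,
     best_body, touch_body, expand_body, reach_body, keep_body, drop_body, branch_body]"

lemma fname_less [simp]:
  "SOLVE < length prog" "MEM < length prog" "DIFF < length prog" "DELETE < length prog"
  "COMPAT < length prog" "COUNT < length prog" "COUNTDEL < length prog" "BEST < length prog"
  "TOUCH < length prog" "EXPAND < length prog" "REACH < length prog" "KEEP < length prog"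
  "DROP < length prog" "BRANCH < length prog"
  by (simp_all add: fname_defs prog_def)

text \<open>\<open>B\<close> is the set of admissible oracle calls.\<close>
definition wp :: "(val \<Rightarrow> val \<Rightarrow> nat) \<Rightarrow> (val \<times> val) set \<Rightarrow> val list \<Rightarrow> expr \<Rightarrow>
    (val \<Rightarrow> nat \<Rightarrow> bool) \<Rightarrow> bool" where
  "wp Q B env e \<Phi> \<longleftrightarrow> (\<exists>v t q. runs Q prog env e v t q \<and> q \<subseteq> B \<and> \<Phi> v t)"

definition wp_list :: "(val \<Rightarrow> val \<Rightarrow> nat) \<Rightarrow> (val \<times> val) set \<Rightarrow> val list \<Rightarrow> expr list \<Rightarrow>
    (val list \<Rightarrow> nat \<Rightarrow> bool) \<Rightarrow> bool" where
  "wp_list Q B env es \<Phi> \<longleftrightarrow> (\<exists>vs t q. runs_list Q prog env es vs t q \<and> q \<subseteq> B \<and> \<Phi> vs t)"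

text \<open>Opaque to the simplifier: symbolic execution stops at a call, where
  \<open>fun_wpI\<close> inserts the specification of the callee.\<close>

definition fun_wp :: "(val \<Rightarrow> val \<Rightarrow> nat) \<Rightarrow> (val \<times> val) set \<Rightarrow> nat \<Rightarrow> val list \<Rightarrow>
    (val \<Rightarrow> nat \<Rightarrow> bool) \<Rightarrow> bool" where
  "fun_wp Q B f xs \<Phi> \<longleftrightarrow> wp Q B xs (prog ! f) \<Phi>"

definition computes :: "(val \<Rightarrow> val \<Rightarrow> nat) \<Rightarrow> (val \<times> val) set \<Rightarrow> nat \<Rightarrow> val list \<Rightarrow>
    val \<Rightarrow> nat \<Rightarrow> bool" where
  "computes Q B f xs v T \<longleftrightarrow> fun_wp Q B f xs (\<lambda>v' t. v' = v \<and> t \<le> T)"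

lemma fun_wpI:
  "computes Q B f xs v T \<Longrightarrow> (\<And>t. t \<le> T \<Longrightarrow> \<Phi> v t) \<Longrightarrow> fun_wp Q B f xs \<Phi>"
  unfolding computes_def fun_wp_def wp_def by blast

lemma wp_mono: "wp Q B env e \<Phi> \<Longrightarrow> (\<And>v t. \<Phi> v t \<Longrightarrow> \<Psi> v t) \<Longrightarrow> wp Q B env e \<Psi>"
  unfolding wp_def by blast

lemma computes_mono: "computes Q B f xs v T \<Longrightarrow> T \<le> T' \<Longrightarrow> computes Q B f xs v T'"
  unfolding computes_def fun_wp_def wp_def by (meson order_trans)

text \<open>This rule and its companions are equivalences, so that the simplifier executes bodies
  symbolically; a stuck operation turns into \<open>False\<close>.\<close>

lemma wp_Var [simp]: "wp Q B env (Var i) \<Phi> \<longleftrightarrow> i < length env \<and> \<Phi> (env ! i) 1"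
  unfolding wp_def by (safe elim!: runs_elims; force intro: runs_runs_list.intros)

lemma wp_Const [simp]: "wp Q B env (Const k) \<Phi> \<longleftrightarrow> \<Phi> (Num k) 1"
  unfolding wp_def by (safe elim!: runs_elims; force intro: runs_runs_list.intros)

lemma wp_Add [simp]: "wp Q B env (Add a b) \<Phi> \<longleftrightarrow> wp Q B env a (\<lambda>x s. wp Q B env b (\<lambda>y t.
    case x of Node _ _ \<Rightarrow> False | Num m \<Rightarrow> (case y of Node _ _ \<Rightarrow> False | Num n \<Rightarrow>
      \<Phi> (Num (m + n)) (s + t + 1))))"
  unfolding wp_def
  by (safe elim!: runs_elims; force intro: runs_runs_list.intros split: val.splits)

lemma wp_Sub [simp]: "wp Q B env (Sub a b) \<Phi> \<longleftrightarrow> wp Q B env a (\<lambda>x s. wp Q B env b (\<lambda>y t.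
    case x of Node _ _ \<Rightarrow> False | Num m \<Rightarrow> (case y of Node _ _ \<Rightarrow> False | Num n \<Rightarrow>
      \<Phi> (Num (m - n)) (s + t + 1))))"
  unfolding wp_def
  by (safe elim!: runs_elims; force intro: runs_runs_list.intros split: val.splits)

lemma wp_Less [simp]: "wp Q B env (Less a b) \<Phi> \<longleftrightarrow> wp Q B env a (\<lambda>x s. wp Q B env b (\<lambda>y t.
    case x of Node _ _ \<Rightarrow> False | Num m \<Rightarrow> (case y of Node _ _ \<Rightarrow> False | Num n \<Rightarrow>
      \<Phi> (Num (if m < n then 1 else 0)) (s + t + 1))))"
  unfolding wp_def
  by (safe elim!: runs_elims; force intro: runs_runs_list.intros split: val.splits)

lemma wp_MkNode [simp]: "wp Q B env (MkNode a b) \<Phi> \<longleftrightarrow>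
    wp Q B env a (\<lambda>x s. wp Q B env b (\<lambda>y t. \<Phi> (Node x y) (s + t + 1)))"
  unfolding wp_def
  by (safe elim!: runs_elims; force intro: runs_runs_list.intros split: val.splits)

lemma wp_Fst [simp]: "wp Q B env (Fst a) \<Phi> \<longleftrightarrow>
    wp Q B env a (\<lambda>x t. case x of Num _ \<Rightarrow> False | Node y z \<Rightarrow> \<Phi> y (t + 1))"
  unfolding wp_def
  by (safe elim!: runs_elims; force intro: runs_runs_list.intros split: val.splits)

lemma wp_Snd [simp]: "wp Q B env (Snd a) \<Phi> \<longleftrightarrow>
    wp Q B env a (\<lambda>x t. case x of Num _ \<Rightarrow> False | Node y z \<Rightarrow> \<Phi> z (t + 1))"
  unfolding wp_def
  by (safe elim!: runs_elims; force intro: runs_runs_list.intros split: val.splits)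

lemma wp_IsNum [simp]: "wp Q B env (IsNum a) \<Phi> \<longleftrightarrow> wp Q B env a (\<lambda>x t.
    case x of Num _ \<Rightarrow> \<Phi> (Num 1) (t + 1) | Node y z \<Rightarrow> \<Phi> (Num 0) (t + 1))"
  unfolding wp_def
  by (safe elim!: runs_elims; force intro: runs_runs_list.intros split: val.splits)

lemma wp_IfNonzero [simp]: "wp Q B env (IfNonzero c a b) \<Phi> \<longleftrightarrow> wp Q B env c (\<lambda>x s.
    case x of Node _ _ \<Rightarrow> False | Num k \<Rightarrow>
      if k \<noteq> 0 then wp Q B env a (\<lambda>v t. \<Phi> v (s + t + 1)) else wp Q B env b (\<lambda>v t. \<Phi> v (s + t + 1)))"
  unfolding wp_def
  by (safe elim!: runs_elims; force intro: runs_runs_list.intros split: val.splits if_splits)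

lemma wp_Bind [simp]: "wp Q B env (Bind a b) \<Phi> \<longleftrightarrow>
    wp Q B env a (\<lambda>x s. wp Q B (x # env) b (\<lambda>v t. \<Phi> v (s + t + 1)))"
  unfolding wp_def
  by (safe elim!: runs_elims; force intro: runs_runs_list.intros)

lemma wp_Query [simp]: "wp Q B env (Query a b) \<Phi> \<longleftrightarrow> wp Q B env a (\<lambda>x s. wp Q B env b (\<lambda>y t.
    (x, y) \<in> B \<and> \<Phi> (Num (Q x y)) (s + t + 1)))"
  unfolding wp_def
  by (safe elim!: runs_elims; force intro: runs_runs_list.intros)

lemma wp_Call [simp]: "wp Q B env (Call f as) \<Phi> \<longleftrightarrow> wp_list Q B env as (\<lambda>xs s.
    f < length prog \<and> fun_wp Q B f xs (\<lambda>v t. \<Phi> v (s + t + 1)))"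
  unfolding wp_def wp_list_def fun_wp_def
  by (safe elim!: runs_elims; force intro: runs_runs_list.intros)

lemma wp_list_Nil [simp]: "wp_list Q B env [] \<Phi> \<longleftrightarrow> \<Phi> [] 0"
  unfolding wp_list_def by (safe elim!: runs_elims; force intro: runs_runs_list.intros)

lemma wp_list_Cons [simp]: "wp_list Q B env (a # as) \<Phi> \<longleftrightarrow>
    wp Q B env a (\<lambda>x s. wp_list Q B env as (\<lambda>xs t. \<Phi> (x # xs) (s + t)))"
  unfolding wp_def wp_list_def
  by (safe elim!: runs_elims; force intro: runs_runs_list.intros)

text \<open>Function numbers are kept as constants, and this lemma looks up the body of the one
  function at hand; the calls inside it stay folded and are met by induction hypotheses and earlier
  specifications.\<close>

lemma computes_body:
  "computes Q B SOLVE xs v T \<longleftrightarrow> wp Q B xs solve_body (\<lambda>v' t. v' = v \<and> t \<le> T)"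
  "computes Q B MEM xs v T \<longleftrightarrow> wp Q B xs mem_body (\<lambda>v' t. v' = v \<and> t \<le> T)"
  "computes Q B DIFF xs v T \<longleftrightarrow> wp Q B xs diff_body (\<lambda>v' t. v' = v \<and> t \<le> T)"
  "computes Q B DELETE xs v T \<longleftrightarrow> wp Q B xs delete_body (\<lambda>v' t. v' = v \<and> t \<le> T)"
  "computes Q B COMPAT xs v T \<longleftrightarrow> wp Q B xs compat_body (\<lambda>v' t. v' = v \<and> t \<le> T)"
  "computes Q B COUNT xs v T \<longleftrightarrow> wp Q B xs count_body (\<lambda>v' t. v' = v \<and> t \<le> T)"
  "computes Q B COUNTDEL xs v T \<longleftrightarrow> wp Q B xs countdel_body (\<lambda>v' t. v' = v \<and> t \<le> T)"
  "computes Q B BEST xs v T \<longleftrightarrow> wp Q B xs best_body (\<lambda>v' t. v' = v \<and> t \<le> T)"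
  "computes Q B TOUCH xs v T \<longleftrightarrow> wp Q B xs touch_body (\<lambda>v' t. v' = v \<and> t \<le> T)"
  "computes Q B EXPAND xs v T \<longleftrightarrow> wp Q B xs expand_body (\<lambda>v' t. v' = v \<and> t \<le> T)"
  "computes Q B REACH xs v T \<longleftrightarrow> wp Q B xs reach_body (\<lambda>v' t. v' = v \<and> t \<le> T)"
  "computes Q B KEEP xs v T \<longleftrightarrow> wp Q B xs keep_body (\<lambda>v' t. v' = v \<and> t \<le> T)"
  "computes Q B DROP xs v T \<longleftrightarrow> wp Q B xs drop_body (\<lambda>v' t. v' = v \<and> t \<le> T)"
  "computes Q B BRANCH xs v T \<longleftrightarrow> wp Q B xs branch_body (\<lambda>v' t. v' = v \<and> t \<le> T)"
  by (simp_all add: computes_def fun_wp_def prog_def fname_defs)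

section \<open>The subroutines\<close>

abbreviation nums :: "nat list \<Rightarrow> val" where
  "nums xs \<equiv> enc_list (map Num xs)"

text \<open>The constants in this and the following cost bounds are not optimised; they are rounded
  up until the list inductions close by linear arithmetic.\<close>

lemma computes_MEM:
  "computes Q B MEM [Num x, nums L] (Num (of_bool (x \<in> set L))) (20 * (length L + 1))"
proof (induction L)
  case Nil
  show ?case
    by (simp add: computes_body mem_body_def)
next
  case (Cons y L)
  show ?case
    unfolding computes_body mem_body_def
    by (auto intro!: fun_wpI[OF Cons.IH])
qed

lemma computes_DIFF:
  "computes Q B DIFF [nums L, nums D] (nums (filter (\<lambda>x. x \<notin> set D) L))
     (40 * (length D + 1) * (length L + 1))"
proof (induction L)
  case Nil
  show ?case
    by (simp add: computes_body diff_body_def)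
next
  case (Cons y L)
  show ?case
    unfolding computes_body diff_body_def
    by (auto intro!: fun_wpI[OF Cons.IH] fun_wpI[OF computes_MEM])
qed

section \<open>Encoded graphs and the deletion of vertices\<close>

definition nbrs :: "nat graph \<Rightarrow> nat \<Rightarrow> nat list" where
  "nbrs G u = sorted_list_of_set {v \<in> verts G. {u, v} \<in> edges G}"

definition vlist :: "nat graph \<Rightarrow> nat list" where
  "vlist G = sorted_list_of_set (verts G)"

definition hent :: "nat graph \<Rightarrow> nat \<Rightarrow> val" where
  "hent G u = Node (Num u) (nums (nbrs G u))"

definition gent :: "nat graph \<Rightarrow> (nat \<Rightarrow> nat) \<Rightarrow> nat \<Rightarrow> val" where
  "gent G w u = Node (Num u) (Node (Num (w u)) (nums (nbrs G u)))"

lemma enc_graph_eq: "enc_graph G = enc_list (map (hent G) (vlist G))"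
  by (simp add: enc_graph_def vlist_def hent_def[abs_def] enc_nbrs_def nbrs_def)

lemma enc_wgraph_eq: "enc_wgraph G w = enc_list (map (gent G w) (vlist G))"
  by (simp add: enc_wgraph_def vlist_def gent_def[abs_def] enc_nbrs_def nbrs_def)

lemma finite_verts: "simple_graph G \<Longrightarrow> finite (verts G)"
  by (simp add: simple_graph_def)

lemma set_nbrs: "simple_graph G \<Longrightarrow> set (nbrs G u) = {v \<in> verts G. {u, v} \<in> edges G}"
  by (simp add: nbrs_def finite_verts)

lemma set_vlist: "simple_graph G \<Longrightarrow> set (vlist G) = verts G"
  by (simp add: vlist_def finite_verts)

lemma distinct_vlist: "distinct (vlist G)"
  by (simp add: vlist_def)

lemma length_vlist: "length (vlist G) = card (verts G)"
  by (simp add: vlist_def)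

lemma length_nbrs: "simple_graph G \<Longrightarrow> length (nbrs G u) \<le> card (verts G)"
  by (simp add: nbrs_def finite_verts card_mono)

text \<open>Vertex lists are sorted and filtering keeps them so: the program obtains the canonical
  encoding of a subgraph, which the oracles expect, without sorting.\<close>

lemma filter_sorted_list_of_set:
  "finite A \<Longrightarrow> filter P (sorted_list_of_set A) = sorted_list_of_set {x \<in> A. P x}"
  by (rule sorted_distinct_set_unique) (auto intro: sorted_wrt_filter)

lemma verts_induced [simp]: "verts (induced G S) = S"
  by (simp add: induced_def)

lemma edges_induced [simp]: "edges (induced G S) = {e \<in> edges G. e \<subseteq> S}"
  by (simp add: induced_def)

lemma simple_graph_induced: "simple_graph G \<Longrightarrow> S \<subseteq> verts G \<Longrightarrow> simple_graph (induced G S)"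
  by (auto simp: simple_graph_def intro: finite_subset)

definition delete :: "'a graph \<Rightarrow> 'a set \<Rightarrow> 'a graph" where
  "delete G D = induced G (verts G - D)"

definition closed_nbhd :: "'a graph \<Rightarrow> 'a \<Rightarrow> 'a set" where
  "closed_nbhd G x = insert x {v \<in> verts G. {x, v} \<in> edges G}"

lemma simple_graph_delete: "simple_graph G \<Longrightarrow> simple_graph (delete G D)"
  by (simp add: delete_def simple_graph_induced)

text \<open>The induction is over any list of vertices of \<open>G\<close>: when only a suffix of
  the encoding is left, its neighbour lists still refer to the whole graph.\<close>

lemma computes_DELETE:
  assumes "simple_graph G"
  shows "computes Q B DELETE [enc_wgraph G w, nums D] (enc_wgraph (delete G (set D)) w)
    (150 * (length D + 1) * (card (verts G) + 1) * (card (verts G) + 1))"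
proof -
  \<comment> \<open>Allowance per vertex: one list difference \<open>b\<close>, one membership test
    \<open>c\<close> and 40 further operations.\<close>
  define a where "a = 150 * (length D + 1) * (card (verts G) + 1)"
  define b where "b = 40 * (length D + 1) * (card (verts G) + 1)"
  define c where "c = 20 * (length D + 1)"
  have abc: "b + c + 40 \<le> a"
    by (simp add: a_def b_def c_def algebra_simps)
  have diff: "computes Q B DIFF [nums (nbrs G u), nums D] (nums (nbrs (delete G (set D)) u)) b"
    if "u \<notin> set D" "u \<in> verts G" for u
  proof -
    have "filter (\<lambda>x. x \<notin> set D) (nbrs G u) = nbrs (delete G (set D)) u"
      using that unfolding nbrs_def
      by (subst filter_sorted_list_of_set)
        (auto simp: finite_verts assms delete_def intro!: arg_cong[where f = sorted_list_of_set])
    moreover have "40 * (length D + 1) * (length (nbrs G u) + 1) \<le> b"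
      unfolding b_def using length_nbrs[OF assms, of u] by (intro mult_le_mono) auto
    ultimately show ?thesis
      using computes_mono[OF computes_DIFF[where L = "nbrs G u" and D = D]] by metis
  qed
  have mem: "computes Q B MEM [Num u, nums D] (Num (of_bool (u \<in> set D))) c" for u
    using computes_MEM[where L = D] by (simp add: c_def)
  have "computes Q B DELETE [enc_list (map (gent G w) vs), nums D]
    (enc_list (map (gent (delete G (set D)) w) (filter (\<lambda>x. x \<notin> set D) vs))) (a * (length vs + 1))"
    if "set vs \<subseteq> verts G" for vs
    using that
  proof (induction vs)
    case Nil
    show ?case
      using abc by (simp add: computes_body delete_body_def)
  next
    case (Cons y vs)
    then have y: "y \<in> verts G" "set vs \<subseteq> verts G"
      by auto
    show ?case
      unfolding computes_body delete_body_def
      using abc y by (auto simp: gent_def intro!: fun_wpI[OF Cons.IH] fun_wpI[OF diff] fun_wpI[OF mem])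
  qed
  from this[of "vlist G"] show ?thesis
    unfolding enc_wgraph_eq
    by (simp add: set_vlist[OF assms] length_vlist a_def vlist_def filter_sorted_list_of_set
        finite_verts[OF assms] delete_def set_diff_eq)
qed

lemma computes_DELETE_vertex:
  assumes "simple_graph G"
  shows "computes Q B DELETE [enc_wgraph G w, Node (Num x) (Num 0)] (enc_wgraph (delete G {x}) w)
    (400 * (card (verts G) + 1) ^ 3)"
proof -
  have "150 * (length [x] + 1) * (card (verts G) + 1) * (card (verts G) + 1) \<le> 400 * (card (verts G) + 1) ^ 3"
    by (simp add: algebra_simps power3_eq_cube)
  from computes_mono[OF computes_DELETE[OF assms] this] show ?thesis
    by simp
qed

lemma computes_DELETE_nbhd:
  assumes "simple_graph G"
  shows "computes Q B DELETE [enc_wgraph G w, Node (Num x) (nums (nbrs G x))]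
    (enc_wgraph (delete G (closed_nbhd G x)) w) (400 * (card (verts G) + 1) ^ 3)"
proof -
  define n where "n = card (verts G)"
  have "length (x # nbrs G x) \<le> n + 1"
    using length_nbrs[OF assms, of x] by (simp add: n_def)
  then have "150 * (length (x # nbrs G x) + 1) \<le> 150 * (n + 2)"
    by (intro mult_le_mono) auto
  also have "\<dots> \<le> 400 * (n + 1)"
    by simp
  finally have "150 * (length (x # nbrs G x) + 1) \<le> 400 * (n + 1)" .
  then have "150 * (length (x # nbrs G x) + 1) * (n + 1) * (n + 1) \<le> 400 * (n + 1) * (n + 1) * (n + 1)"
    by (intro mult_le_mono1)
  also have "\<dots> = 400 * (n + 1) ^ 3"
    by (simp only: power3_eq_cube mult.assoc)
  finally show ?thesis
    using computes_mono[OF computes_DELETE[OF assms, where D = "x # nbrs G x"]]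
    by (simp add: closed_nbhd_def set_nbrs[OF assms] n_def)
qed

section \<open>Counting embeddings by exhaustive extension\<close>

definition pairs :: "(nat \<times> nat) list \<Rightarrow> val" where
  "pairs ps = enc_list (map (\<lambda>(u, s). Node (Num u) (Num s)) ps)"

lemma pairs_simps [simp]:
  "pairs [] = Num 0" "pairs ((u, s) # ps) = Node (Node (Num u) (Num s)) (pairs ps)"
  by (simp_all add: pairs_def)

lemma computes_COMPAT:
  "computes Q B COMPAT [pairs ps, nums L, Num s, nums M]
    (Num (of_bool (list_all (\<lambda>(u', s'). s' \<noteq> s \<and> (u' \<in> set L \<longleftrightarrow> s' \<in> set M)) ps)))
    (100 * (length L + length M + 1) * (length ps + 1))"
proof (induction ps)
  case Nil
  show ?case
    by (simp add: computes_body compat_body_def)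
next
  case (Cons p ps)
  obtain u' s' where [simp]: "p = (u', s')"
    by fastforce
  show ?case
    unfolding computes_body compat_body_def
    by (auto intro!: fun_wpI[OF Cons.IH] fun_wpI[OF computes_MEM])
qed

definition compat :: "'a graph \<Rightarrow> 'b graph \<Rightarrow> 'a \<Rightarrow> 'b \<Rightarrow> ('a \<times> 'b) list \<Rightarrow> bool" where
  "compat H G u s ps \<longleftrightarrow>
     (\<forall>(u', s') \<in> set ps. s' \<noteq> s \<and> ({u, u'} \<in> edges H \<longleftrightarrow> {s, s'} \<in> edges G))"

text \<open>Embeddings are represented by their lists of values: as functions, those that differ
  only outside the pattern would be counted separately.\<close>

fun exts :: "'a graph \<Rightarrow> 'b graph \<Rightarrow> 'a list \<Rightarrow> ('a \<times> 'b) list \<Rightarrow> 'b list set" where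
  "exts H G [] ps = {[]}"
| "exts H G (u # us) ps =
     (\<Union>s \<in> {s \<in> verts G. compat H G u s ps}. (#) s ` exts H G us ((u, s) # ps))"

lemma finite_exts: "finite (verts G) \<Longrightarrow> finite (exts H G us ps)"
  by (induction us arbitrary: ps) auto

lemma card_exts_Cons:
  assumes "finite (verts G)"
  shows "card (exts H G (u # us) ps) =
    (\<Sum>s \<in> verts G. if compat H G u s ps then card (exts H G us ((u, s) # ps)) else 0)"
proof -
  have "card (exts H G (u # us) ps) =
      (\<Sum>s \<in> {s \<in> verts G. compat H G u s ps}. card ((#) s ` exts H G us ((u, s) # ps)))"
    unfolding exts.simps using assms by (intro card_UN_disjoint) (auto simp: finite_exts)
  also have "\<dots> = (\<Sum>s \<in> {s \<in> verts G. compat H G u s ps}. card (exts H G us ((u, s) # ps)))"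
    by (intro sum.cong refl card_image) (auto simp: inj_on_def)
  also have "\<dots> = (\<Sum>s \<in> verts G. if compat H G u s ps then card (exts H G us ((u, s) # ps)) else 0)"
    using assms by (simp add: sum.inter_filter)
  finally show ?thesis .
qed

definition count_cost :: "nat \<Rightarrow> nat \<Rightarrow> nat" where
  "count_cost h n = 200 * (h + n + 1) * (h + 1)"

text \<open>Two nested inductions mirror the program: over the pattern vertices left and, for each,
  over the candidates \<open>rem\<close>. The bound on \<open>length us + length ps\<close> limits
  the length of \<open>ps\<close> and so the cost of a compatibility test.\<close>

lemma computes_COUNT_aux:
  fixes G H :: "nat graph"
  assumes G: "simple_graph G" and H: "simple_graph H"
  defines "n \<equiv> card (verts G)" and "h \<equiv> card (verts H)"
  shows "set us \<subseteq> verts H \<Longrightarrow> set ps \<subseteq> verts H \<times> verts G \<Longrightarrow> length us + length ps \<le> h \<Longrightarrow>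
    computes Q B COUNT [enc_list (map (hent H) us), pairs ps, enc_wgraph G w, enc_wgraph G w]
      (Num (card (exts H G us ps))) (count_cost h n * (n + 1) * (n + 2) ^ length us)"
proof (induction us arbitrary: ps)
  case Nil
  have "6 \<le> count_cost h n * (n + 1)"
    by (simp add: count_cost_def)
  then show ?case
    by (simp add: computes_body count_body_def)
next
  case (Cons u us)
  define A where "A = count_cost h n"
  \<comment> \<open>A candidate costs at most one recursive count \<open>X\<close> plus
    \<open>A\<close>, which covers the compatibility test and the operations around it. The base n +
    2 instead of n + 1 makes room for \<open>A\<close>.\<close>
  define X where "X = A * (n + 1) * (n + 2) ^ length us"
  define Y where "Y = A * (n + 2) ^ length (u # us)"
  have XY: "X + A \<le> Y"
  proof -
    have "A * 1 \<le> A * (n + 2) ^ length us"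
      by (intro mult_le_mono) auto
    then show ?thesis
      by (simp add: X_def Y_def algebra_simps)
  qed
  have u: "u \<in> verts H"
    using Cons.prems by simp
  have compat: "computes Q B COMPAT [pairs ps, nums (nbrs H u), Num s, nums (nbrs G s)]
      (Num (of_bool (compat H G u s ps))) (A - 60)" if "s \<in> verts G" for s
  proof -
    have eq: "list_all (\<lambda>(u', s'). s' \<noteq> s \<and> (u' \<in> set (nbrs H u) \<longleftrightarrow> s' \<in> set (nbrs G s))) ps \<longleftrightarrow>
        compat H G u s ps"
      using Cons.prems(2) unfolding compat_def list_all_iff set_nbrs[OF G] set_nbrs[OF H] by blast
    have "100 * (length (nbrs H u) + length (nbrs G s) + 1) * (length ps + 1) \<le> 100 * (h + n + 1) * (h + 1)"
      using length_nbrs[OF G, of s] length_nbrs[OF H, of u] Cons.prems(3)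
      unfolding n_def[symmetric] h_def[symmetric] by (intro mult_le_mono) auto
    also have "\<dots> \<le> A - 60"
      by (simp add: A_def count_cost_def algebra_simps)
    finally show ?thesis
      using computes_mono[OF computes_COMPAT] unfolding eq[symmetric] by blast
  qed
  have A: "60 \<le> A"
    by (simp add: A_def count_cost_def)
  have rec: "computes Q B COUNT [enc_list (map (hent H) us), Node (Node (Num u) (Num s)) (pairs ps),
      enc_wgraph G w, enc_wgraph G w] (Num (card (exts H G us ((u, s) # ps)))) X" if "s \<in> verts G" for s
    using Cons.IH[of "(u, s) # ps"] Cons.prems u that by (simp add: X_def A_def)
  have "computes Q B COUNT [enc_list (map (hent H) (u # us)), pairs ps, enc_wgraph G w,
        enc_list (map (gent G w) rem)]
      (Num (\<Sum>s\<leftarrow>rem. if compat H G u s ps then card (exts H G us ((u, s) # ps)) else 0))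
      (Y * (length rem + 1))" if "set rem \<subseteq> verts G" for rem
    using that
  proof (induction rem)
    case Nil
    show ?case
      using XY A by (simp add: computes_body count_body_def hent_def[of H u])
  next
    case (Cons s rem)
    have s: "s \<in> verts G" and rem: "set rem \<subseteq> verts G"
      using Cons.prems by auto
    have IH: "computes Q B COUNT [Node (Node (Num u) (nums (nbrs H u))) (enc_list (map (hent H) us)),
        pairs ps, enc_wgraph G w, enc_list (map (gent G w) rem)]
      (Num (\<Sum>s\<leftarrow>rem. if compat H G u s ps then card (exts H G us ((u, s) # ps)) else 0))
      (Y * (length rem + 1))"
      using Cons.IH[OF rem] by (simp add: hent_def[of H u])
    show ?case
      unfolding computes_body count_body_def
      using s A XY
      by (auto simp: hent_def[of H u] gent_def intro!: fun_wpI[OF compat] fun_wpI[OF rec] fun_wpI[OF IH])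
  qed
  from this[of "vlist G"]
  have "computes Q B COUNT [enc_list (map (hent H) (u # us)), pairs ps, enc_wgraph G w, enc_wgraph G w]
      (Num (\<Sum>s\<leftarrow>vlist G. if compat H G u s ps then card (exts H G us ((u, s) # ps)) else 0))
      (Y * (n + 1))"
    by (simp add: set_vlist[OF G] length_vlist n_def enc_wgraph_eq)
  then show ?case
    unfolding card_exts_Cons[OF finite_verts[OF G]] sum_list_distinct_conv_sum_set[OF distinct_vlist]
      set_vlist[OF G]
    by (simp add: Y_def A_def algebra_simps)
qed

definition num_emb :: "nat graph \<Rightarrow> nat graph \<Rightarrow> nat" where
  "num_emb F G = card (exts F G (vlist F) [])"

definition emb_cost :: "nat \<Rightarrow> nat \<Rightarrow> nat" where
  "emb_cost h n = count_cost h n * (n + 1) * (n + 2) ^ h"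

lemma count_cost_mono: "h \<le> h' \<Longrightarrow> n \<le> n' \<Longrightarrow> count_cost h n \<le> count_cost h' n'"
  unfolding count_cost_def by (intro mult_le_mono) auto

lemma emb_cost_mono:
  assumes "h \<le> h'" "n \<le> n'"
  shows "emb_cost h n \<le> emb_cost h' n'"
proof -
  have "(n + 2) ^ h \<le> (n + 2) ^ h'"
    using assms by (intro power_increasing) auto
  also have "\<dots> \<le> (n' + 2) ^ h'"
    using assms by (intro power_mono) auto
  finally show ?thesis
    unfolding emb_cost_def using assms by (intro mult_le_mono count_cost_mono) auto
qed

lemma computes_COUNT:
  assumes "simple_graph G" "simple_graph F" "card (verts F) \<le> h" "card (verts G) \<le> n"
  shows "computes Q B COUNT [enc_graph F, Num 0, enc_wgraph G w, enc_wgraph G w]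
    (Num (num_emb F G)) (emb_cost h n)"
proof -
  have "computes Q B COUNT [enc_graph F, Num 0, enc_wgraph G w, enc_wgraph G w]
      (Num (num_emb F G)) (emb_cost (card (verts F)) (card (verts G)))"
    using computes_COUNT_aux[OF assms(1,2), of "vlist F" "[]"]
    by (simp add: set_vlist assms length_vlist enc_graph_eq num_emb_def emb_cost_def)
  then show ?thesis
    by (rule computes_mono) (intro emb_cost_mono assms)
qed

section \<open>Choosing the branching vertex\<close>

lemma card_delete: "simple_graph G \<Longrightarrow> card (verts (delete G D)) \<le> card (verts G)"
  by (simp add: delete_def card_mono finite_verts)

definition best_cost :: "nat \<Rightarrow> nat \<Rightarrow> nat" where
  "best_cost h n = 400 * (n + 1) ^ 3 + emb_cost h n + 100"

lemma computes_COUNTDEL: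
  assumes G: "simple_graph G" and F: "simple_graph F"
    and h: "card (verts F) \<le> h" and n: "card (verts G) \<le> n"
  shows "computes Q B COUNTDEL [enc_graph F, enc_wgraph G w, gent G w x]
    (Num (num_emb F (delete G (closed_nbhd G x)))) (best_cost h n - 50)"
proof -
  have "400 * (card (verts G) + 1) ^ 3 \<le> 400 * (n + 1) ^ 3"
    using n by (intro mult_le_mono power_mono) auto
  note del = computes_mono[OF computes_DELETE_nbhd[OF G] this]
  note count = computes_COUNT[OF simple_graph_delete[OF G] F h order_trans[OF card_delete[OF G] n]]
  show ?thesis
    unfolding computes_body countdel_body_def gent_def
    by (auto simp: best_cost_def intro!: fun_wpI[OF del] fun_wpI[OF count])
qed

lemma computes_BEST:
  assumes G: "simple_graph G" and F: "simple_graph F"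
    and h: "card (verts F) \<le> h" and n: "card (verts G) \<le> n" and nonempty: "verts G \<noteq> {}"
  shows "\<exists>x \<in> verts G. \<exists>c. computes Q B BEST [enc_graph F, enc_wgraph G w, enc_wgraph G w]
      (Node c (gent G w x)) (best_cost h n * (n + 1)) \<and>
    (\<forall>y \<in> verts G. num_emb F (delete G (closed_nbhd G x)) \<le> num_emb F (delete G (closed_nbhd G y)))"
proof -
  define f where "f x = num_emb F (delete G (closed_nbhd G x))" for x
  define X where "X = best_cost h n"
  have X: "100 \<le> X"
    by (simp add: X_def best_cost_def)
  have del: "computes Q B COUNTDEL [enc_graph F, enc_wgraph G w, gent G w x] (Num (f x)) (X - 50)" for x
    unfolding f_def X_def using computes_COUNTDEL[OF G F h n] .
  have "\<exists>x \<in> set rem. computes Q B BEST [enc_graph F, enc_wgraph G w, enc_list (map (gent G w) rem)]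
      (Node (Num (f x)) (gent G w x)) (X * length rem) \<and> (\<forall>y \<in> set rem. f x \<le> f y)"
    if "rem \<noteq> []" for rem
    using that
  \<comment> \<open>\<open>BEST\<close> stops at a list of one element, hence a base case of length
    1.\<close>
  proof (induction rem rule: induct_list012)
    case 1
    then show ?case by simp
  next
    case (2 y)
    show ?case
      unfolding computes_body best_body_def
      using X by (auto intro!: fun_wpI[OF del])
  next
    case (3 y z rem)
    then obtain x where x: "x \<in> set (z # rem)" "\<forall>y \<in> set (z # rem). f x \<le> f y"
      and comp: "computes Q B BEST [enc_graph F, enc_wgraph G w, enc_list (map (gent G w) (z # rem))]
        (Node (Num (f x)) (gent G w x)) (X * length (z # rem))"
      by blast
    note comp = comp[simplified]
    have "computes Q B BEST [enc_graph F, enc_wgraph G w, enc_list (map (gent G w) (y # z # rem))]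
        (Node (Num (f (if f y < f x then y else x))) (gent G w (if f y < f x then y else x)))
        (X * length (y # z # rem))"
      unfolding computes_body best_body_def
      using X by (auto intro!: fun_wpI[OF del] fun_wpI[OF comp])
    moreover have "\<forall>y' \<in> set (y # z # rem). f (if f y < f x then y else x) \<le> f y'"
      using x(2) by auto
    moreover have "(if f y < f x then y else x) \<in> set (y # z # rem)"
      using x(1) by auto
    ultimately show ?case
      by blast
  qed
  moreover have "vlist G \<noteq> []"
    using nonempty set_vlist[OF G] by (metis set_empty)
  ultimately obtain x where x: "x \<in> verts G" "\<forall>y \<in> verts G. f x \<le> f y"
    and comp: "computes Q B BEST [enc_graph F, enc_wgraph G w, enc_wgraph G w]
      (Node (Num (f x)) (gent G w x)) (X * card (verts G))"
    using set_vlist[OF G] length_vlist enc_wgraph_eq by metis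
  have "X * card (verts G) \<le> X * (n + 1)"
    using n by (intro mult_le_mono) auto
  from computes_mono[OF comp this] x show ?thesis
    unfolding f_def X_def by blast
qed

section \<open>Splitting a component off the pattern\<close>

lemma computes_TOUCH:
  "computes Q B TOUCH [nums L, nums R] (Num (of_bool (set L \<inter> set R \<noteq> {})))
     (60 * (length R + 1) * (length L + 1))"
proof (induction L)
  case Nil
  show ?case
    by (simp add: computes_body touch_body_def)
next
  case (Cons y L)
  show ?case
    unfolding computes_body touch_body_def
    by (auto intro!: fun_wpI[OF Cons.IH] fun_wpI[OF computes_MEM]; blast)
qed

definition expand :: "nat graph \<Rightarrow> nat list \<Rightarrow> nat list" where
  "expand H R = filter (\<lambda>u. set (u # nbrs H u) \<inter> set R \<noteq> {}) (vlist H)"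

lemma length_expand: "length (expand H R) \<le> card (verts H)"
  unfolding expand_def length_vlist[symmetric] by (rule length_filter_le)

lemma computes_EXPAND:
  assumes H: "simple_graph H" and h: "card (verts H) \<le> h" and R: "length R \<le> h"
  shows "computes Q B EXPAND [enc_graph H, nums R] (nums (expand H R)) (200 * (h + 1) ^ 3)"
proof -
  define a where "a = 200 * (h + 1) * (h + 1)"
  have touch: "computes Q B TOUCH [Node (Num u) (nums (nbrs H u)), nums R]
      (Num (of_bool (set (u # nbrs H u) \<inter> set R \<noteq> {}))) (a - 50)" for u
  proof -
    have "length (u # nbrs H u) + 1 \<le> 2 * (h + 1)"
      using length_nbrs[OF H, of u] h by simp
    then have "60 * (length R + 1) * (length (u # nbrs H u) + 1) \<le> 60 * (h + 1) * (2 * (h + 1))"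
      using R by (intro mult_le_mono) auto
    also have "\<dots> \<le> a - 50"
      by (simp add: a_def algebra_simps)
    finally show ?thesis
      using computes_mono[OF computes_TOUCH[where L = "u # nbrs H u" and R = R]] by simp
  qed
  have a: "50 \<le> a"
    by (simp add: a_def)
  have "computes Q B EXPAND [enc_list (map (hent H) vs), nums R]
      (nums (filter (\<lambda>u. set (u # nbrs H u) \<inter> set R \<noteq> {}) vs)) (a * (length vs + 1))" for vs
  proof (induction vs)
    case Nil
    show ?case
      using a by (simp add: computes_body expand_body_def)
  next
    case (Cons y vs)
    show ?case
      unfolding computes_body expand_body_def
      using a by (auto simp: hent_def[of H y] simp del: set_simps
          intro!: fun_wpI[OF touch] fun_wpI[OF Cons.IH])
  qed
  from this[of "vlist H"]
  have "computes Q B EXPAND [enc_graph H, nums R] (nums (expand H R)) (a * (card (verts H) + 1))"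
    by (simp add: expand_def length_vlist enc_graph_eq)
  moreover have "a * (card (verts H) + 1) \<le> a * (h + 1)"
    using h by (intro mult_le_mono) auto
  moreover have "a * (h + 1) = 200 * (h + 1) ^ 3"
    by (simp only: a_def power3_eq_cube mult.assoc)
  ultimately show ?thesis
    using computes_mono by metis
qed

text \<open>The encoding of \<open>H\<close> doubles as the round counter: its length is the number
  of rounds that \<open>set_reach\<close> asks for.\<close>

lemma computes_REACH:
  assumes H: "simple_graph H" and h: "card (verts H) \<le> h" and R: "length R \<le> h"
  shows "computes Q B REACH [enc_graph H, enc_graph H, nums R]
    (nums ((expand H ^^ card (verts H)) R)) (220 * (h + 1) ^ 4)"
proof -
  define a where "a = 220 * (h + 1) ^ 3"
  define b where "b = 200 * (h + 1) ^ 3"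
  have "1 \<le> (h + 1) ^ 3"
    by simp
  then have ab: "b + 20 \<le> a"
    unfolding a_def b_def by linarith
  have expand: "computes Q B EXPAND [enc_graph H, nums R] (nums (expand H R)) b" if "length R \<le> h" for R
    unfolding b_def using computes_EXPAND[OF H h that] .
  have "computes Q B REACH [enc_list fs, enc_graph H, nums R]
      (nums ((expand H ^^ length fs) R)) (a * (length fs + 1))" for fs
    using R
  proof (induction fs arbitrary: R)
    case Nil
    show ?case
      using ab unfolding computes_body reach_body_def by simp
  next
    case (Cons f fs)
    have R: "length (expand H R) \<le> h"
      using length_expand[of H R] h by simp
    show ?case
      unfolding computes_body reach_body_def
      using ab by (auto simp: funpow_swap1 intro!: fun_wpI[OF expand[OF Cons.prems]] fun_wpI[OF Cons.IH[OF R]])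
  qed
  from this[of "map (hent H) (vlist H)"]
  have "computes Q B REACH [enc_graph H, enc_graph H, nums R]
      (nums ((expand H ^^ card (verts H)) R)) (a * (card (verts H) + 1))"
    by (simp add: length_vlist enc_graph_eq)
  moreover have "a * (card (verts H) + 1) \<le> a * (h + 1)"
    using h by (intro mult_le_mono) auto
  moreover have p4: "x ^ 4 = x ^ 3 * x" for x :: nat
    by (simp add: numeral_eq_Suc mult_ac)
  moreover have "a * (h + 1) = 220 * (h + 1) ^ 4"
    by (simp only: a_def mult.assoc p4)
  ultimately show ?thesis
    using computes_mono by metis
qed

lemma computes_KEEP_DROP:
  assumes R: "length R \<le> h" and h: "card (verts H) \<le> h"
  shows "computes Q B KEEP [enc_graph H, nums R]
      (enc_list (map (hent H) (filter (\<lambda>u. u \<in> set R) (vlist H)))) (60 * (h + 1) ^ 2)"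
    and "computes Q B DROP [enc_graph H, nums R]
      (enc_list (map (hent H) (filter (\<lambda>u. u \<notin> set R) (vlist H)))) (60 * (h + 1) ^ 2)"
proof -
  have mem: "computes Q B MEM [Num u, nums R] (Num (of_bool (u \<in> set R))) (20 * (h + 1))" for u
    using computes_mono[OF computes_MEM] R by simp
  have le: "60 * (h + 1) * (length (vlist H) + 1) \<le> 60 * (h + 1) ^ 2"
    using h unfolding power2_eq_square mult.assoc by (intro mult_le_mono) (auto simp: length_vlist)
  have "computes Q B KEEP [enc_list (map (hent H) vs), nums R]
      (enc_list (map (hent H) (filter (\<lambda>u. u \<in> set R) vs))) (60 * (h + 1) * (length vs + 1))" for vs
  proof (induction vs)
    case Nil
    show ?case
      by (simp add: computes_body keep_body_def)
  next
    case (Cons y vs)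
    show ?case
      unfolding computes_body keep_body_def
      by (auto simp: hent_def[of H y] intro!: fun_wpI[OF Cons.IH] fun_wpI[OF mem])
  qed
  from computes_mono[OF this le] show "computes Q B KEEP [enc_graph H, nums R]
      (enc_list (map (hent H) (filter (\<lambda>u. u \<in> set R) (vlist H)))) (60 * (h + 1) ^ 2)"
    by (simp add: enc_graph_eq)
  have "computes Q B DROP [enc_list (map (hent H) vs), nums R]
      (enc_list (map (hent H) (filter (\<lambda>u. u \<notin> set R) vs))) (60 * (h + 1) * (length vs + 1))" for vs
  proof (induction vs)
    case Nil
    show ?case
      by (simp add: computes_body drop_body_def)
  next
    case (Cons y vs)
    show ?case
      unfolding computes_body drop_body_def
      by (auto simp: hent_def[of H y] intro!: fun_wpI[OF Cons.IH] fun_wpI[OF mem])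
  qed
  from computes_mono[OF this le] show "computes Q B DROP [enc_graph H, nums R]
      (enc_list (map (hent H) (filter (\<lambda>u. u \<notin> set R) (vlist H)))) (60 * (h + 1) ^ 2)"
    by (simp add: enc_graph_eq)
qed

section \<open>Embeddings\<close>

definition embeds :: "'a graph \<Rightarrow> 'b graph \<Rightarrow> ('a \<Rightarrow> 'b) \<Rightarrow> bool" where
  "embeds F G g \<longleftrightarrow> inj_on g (verts F) \<and> g ` verts F \<subseteq> verts G \<and>
     (\<forall>u \<in> verts F. \<forall>v \<in> verts F. {u, v} \<in> edges F \<longleftrightarrow> {g u, g v} \<in> edges G)"

lemma is_free_iff: "is_free F G \<longleftrightarrow> (\<nexists>g. embeds F G g)"
proof -
  have embI: "\<exists>g. embeds F G g" if S: "S \<subseteq> verts G" and iso: "isomorphic (induced G S) F" for S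
  proof -
    obtain f where f: "bij_betw f S (verts F)"
      and e: "\<And>u v. u \<in> S \<Longrightarrow> v \<in> S \<Longrightarrow> {u, v} \<in> edges G \<longleftrightarrow> {f u, f v} \<in> edges F"
      using iso unfolding isomorphic_def by auto
    define g where "g = inv_into S f"
    have g: "bij_betw g (verts F) S"
      unfolding g_def by (rule bij_betw_inv_into[OF f])
    have fg: "f (g u) = u" if "u \<in> verts F" for u
      unfolding g_def by (rule bij_betw_inv_into_right[OF f that])
    have "embeds F G g"
      unfolding embeds_def
    proof (intro conjI ballI)
      show "inj_on g (verts F)" "g ` verts F \<subseteq> verts G"
        using g S by (auto simp: bij_betw_def)
    next
      fix u v assume uv: "u \<in> verts F" "v \<in> verts F"
      then have "g u \<in> S" "g v \<in> S"
        using g by (auto simp: bij_betw_def)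
      from e[OF this] show "{u, v} \<in> edges F \<longleftrightarrow> {g u, g v} \<in> edges G"
        using uv by (simp add: fg)
    qed
    then show ?thesis
      by blast
  qed
  have "\<exists>S \<subseteq> verts G. isomorphic (induced G S) F" if g: "embeds F G g" for g
  proof (intro exI conjI)
    show "g ` verts F \<subseteq> verts G"
      using g by (simp add: embeds_def)
    show "isomorphic (induced G (g ` verts F)) F"
      unfolding isomorphic_def
      by (rule exI[of _ "inv_into (verts F) g"])
        (use g in \<open>auto simp: embeds_def intro!: bij_betw_inv_into inj_on_imp_bij_betw\<close>)
  qed
  with embI show ?thesis
    unfolding is_free_def by blast
qed

lemma embeds_delete_iff:
  "embeds F (delete G D) g \<longleftrightarrow> embeds F G g \<and> g ` verts F \<inter> D = {}"
proof -
  have "{g u, g v} \<subseteq> verts G - D" if "g ` verts F \<subseteq> verts G - D" "u \<in> verts F" "v \<in> verts F" for u v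
    using that by auto
  then show ?thesis
    unfolding embeds_def delete_def by (auto simp: image_subset_iff)
qed

lemma is_free_delete: "is_free F G \<Longrightarrow> is_free F (delete G D)"
  by (simp add: is_free_iff embeds_delete_iff)

text \<open>Unfolds the recursion into a condition on pairs; \<open>sorted_wrt\<close> appears
  because a vertex is compared only with those mapped before it.\<close>

lemma exts_iff:
  "ss \<in> exts H G us ps \<longleftrightarrow> length ss = length us \<and> set ss \<subseteq> verts G \<and>
    (\<forall>(u, s) \<in> set (zip us ss). compat H G u s ps) \<and>
    sorted_wrt (\<lambda>(u', s') (u, s). s' \<noteq> s \<and> ({u, u'} \<in> edges H \<longleftrightarrow> {s, s'} \<in> edges G)) (zip us ss)"
proof (induction us arbitrary: ss ps)
  case Nil
  show ?case by auto
next
  case (Cons u us)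
  show ?case
    by (cases ss) (auto simp: Cons.IH compat_def image_iff)
qed

lemma sorted_wrt_symD:
  assumes "sorted_wrt R xs" "\<And>x y. R x y \<Longrightarrow> R y x" "x \<in> set xs" "y \<in> set xs" "x \<noteq> y"
  shows "R x y"
proof -
  obtain i j where "i < length xs" "j < length xs" "x = xs ! i" "y = xs ! j"
    using assms(3,4) by (metis in_set_conv_nth)
  then show ?thesis
    using assms(1,2,5) by (metis linorder_neqE_nat sorted_wrt_iff_nth_less)
qed

lemma not_edge_refl: "simple_graph G \<Longrightarrow> {u, u} \<notin> edges G"
  by (auto simp: simple_graph_def)

text \<open>The comparison with earlier vertices is a symmetric relation, so it covers all pairs of
  distinct vertices and the enumerated lists are exactly the embeddings.\<close>

lemma exts_eq_embeds:
  assumes F: "simple_graph F" and G: "simple_graph G"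
  shows "exts F G (vlist F) [] = (\<lambda>g. map g (vlist F)) ` {g. embeds F G g}"
proof -
  define us where "us = vlist F"
  have us: "distinct us" "set us = verts F"
    by (simp_all add: us_def distinct_vlist set_vlist[OF F])
  define R where "R g u' u \<longleftrightarrow> g u' \<noteq> g u \<and> ({u, u'} \<in> edges F \<longleftrightarrow> {g u, g u'} \<in> edges G)" for g u' u
  have iff: "map g us \<in> exts F G us [] \<longleftrightarrow> g ` verts F \<subseteq> verts G \<and> sorted_wrt (R g) us" for g
    unfolding exts_iff zip_map2 zip_same_conv_map R_def
    by (auto simp: compat_def us sorted_wrt_map)
  have "map g us \<in> exts F G us [] \<longleftrightarrow> embeds F G g" for g
  proof
    assume "map g us \<in> exts F G us []"
    then have g: "g ` verts F \<subseteq> verts G" and "sorted_wrt (R g) us"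
      by (simp_all add: iff)
    moreover have "R g y x" if "R g x y" for x y
      using that unfolding R_def by (metis insert_commute)
    ultimately have R: "R g u v" if "u \<in> verts F" "v \<in> verts F" "u \<noteq> v" for u v
      using that sorted_wrt_symD[of "R g" us u v] us(2) by blast
    \<comment> \<open>A pair (u, u) is never compared; both sides are false because neither graph
      has loops.\<close>
    have "{u, v} \<in> edges F \<longleftrightarrow> {g u, g v} \<in> edges G" if "u \<in> verts F" "v \<in> verts F" for u v
      using R[OF that] not_edge_refl[OF F] not_edge_refl[OF G]
      by (cases "u = v") (auto simp: R_def insert_commute)
    moreover have "g u \<noteq> g v" if "u \<in> verts F" "v \<in> verts F" "u \<noteq> v" for u v
      using R[OF that] by (simp add: R_def)
    ultimately show "embeds F G g"
      using g unfolding embeds_def inj_on_def by blast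
  next
    assume g: "embeds F G g"
    have "sorted_wrt (R g) us"
      unfolding sorted_wrt_iff_nth_less
    proof (intro allI impI)
      fix i j assume ij: "i < j" "j < length us"
      then have "us ! i \<in> verts F" "us ! j \<in> verts F" "us ! i \<noteq> us ! j"
        using us(1) unfolding us(2)[symmetric] by (simp_all add: nth_eq_iff_index_eq)
      then show "R g (us ! i) (us ! j)"
        using g unfolding R_def embeds_def inj_on_def by blast
    qed
    with g show "map g us \<in> exts F G us []"
      by (simp add: iff embeds_def)
  qed
  moreover have "\<exists>g. ss = map g us" if "ss \<in> exts F G us []" for ss
  proof -
    have "length us = length ss"
      using that by (simp add: exts_iff)
    \<comment> \<open>The listed vertices are distinct, so a list of values defines a
      function.\<close>
    then have "ss = map (the \<circ> map_of (zip us ss)) us"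
      using us(1) by (intro nth_equalityI) (auto simp: map_of_zip_nth)
    then show ?thesis
      by metis
  qed
  ultimately show ?thesis
    unfolding us_def[symmetric] by blast
qed

lemma num_emb_eq_0_iff:
  assumes "simple_graph F" "simple_graph G"
  shows "num_emb F G = 0 \<longleftrightarrow> is_free F G"
proof -
  have "finite (exts F G (vlist F) [])"
    by (intro finite_exts finite_verts assms)
  then have "num_emb F G = 0 \<longleftrightarrow> exts F G (vlist F) [] = {}"
    by (simp add: num_emb_def)
  then show ?thesis
    by (auto simp: is_free_iff exts_eq_embeds[OF assms])
qed

lemma num_emb_le:
  assumes "simple_graph F" "simple_graph G"
  shows "num_emb F G \<le> card (verts G) ^ card (verts F)"
proof -
  have "exts F G (vlist F) [] \<subseteq> {ss. set ss \<subseteq> verts G \<and> length ss = card (verts F)}"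
    by (auto simp: exts_iff length_vlist)
  then have "num_emb F G \<le> card {ss. set ss \<subseteq> verts G \<and> length ss = card (verts F)}"
    unfolding num_emb_def by (intro card_mono finite_lists_length_eq finite_verts assms)
  then show ?thesis
    by (simp add: card_lists_length_eq finite_verts assms)
qed

lemma exts_delete:
  assumes "simple_graph F" "simple_graph G"
  shows "exts F (delete G D) (vlist F) [] = {ss \<in> exts F G (vlist F) []. set ss \<inter> D = {}}"
  unfolding exts_eq_embeds[OF assms] exts_eq_embeds[OF assms(1) simple_graph_delete[OF assms(2)]]
  by (auto simp: embeds_delete_iff set_vlist[OF assms(1)]; blast)

lemma num_emb_delete_le:
  assumes "simple_graph F" "simple_graph G"
  shows "num_emb F (delete G D) \<le> num_emb F G"
  unfolding num_emb_def exts_delete[OF assms]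
  by (intro card_mono finite_exts finite_verts assms) auto

text \<open>Every copy of the second part meets the closed neighbourhood of every copy of the first.
  By averaging over the vertices of one copy of the first part, a single closed neighbourhood
  meets a large fraction of the copies of the second part.\<close>

lemma exists_vertex_hitting:
  assumes H: "simple_graph H" and G: "simple_graph G" and free: "is_free H G"
    and R: "R \<subseteq> verts H" and sep: "\<And>u v. u \<in> R \<Longrightarrow> v \<in> verts H - R \<Longrightarrow> {u, v} \<notin> edges H"
    and emb: "\<not> is_free (induced H R) G" and pos: "num_emb (delete H R) G > 0"
  shows "\<exists>x \<in> verts G. card R * num_emb (delete H R) (delete G (closed_nbhd G x)) + num_emb (delete H R) G
    \<le> card R * num_emb (delete H R) G"
proof -
  define D where "D = delete H R"
  have D: "simple_graph D"
    unfolding D_def by (rule simple_graph_delete[OF H])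
  have vD: "verts D = verts H - R"
    by (simp add: D_def delete_def)
  obtain f where f: "embeds (induced H R) G f"
    using emb by (auto simp: is_free_iff)
  define E where "E = exts D G (vlist D) []"
  define hit where "hit x = {ss \<in> E. set ss \<inter> closed_nbhd G x \<noteq> {}}" for x
  define mu where "mu x = num_emb D (delete G (closed_nbhd G x))" for x
  have finE: "finite E"
    unfolding E_def by (intro finite_exts finite_verts G)
  have mu: "mu x + card (hit x) = card E" for x
  proof -
    have "card ({ss \<in> E. set ss \<inter> closed_nbhd G x = {}} \<union> hit x) =
        card {ss \<in> E. set ss \<inter> closed_nbhd G x = {}} + card (hit x)"
      using finE by (intro card_Un_disjoint) (auto simp: hit_def)
    moreover have "{ss \<in> E. set ss \<inter> closed_nbhd G x = {}} \<union> hit x = E"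
      by (auto simp: hit_def)
    ultimately have "card E = card {ss \<in> E. set ss \<inter> closed_nbhd G x = {}} + card (hit x)"
      by simp
    then show ?thesis
      by (simp add: mu_def num_emb_def exts_delete[OF D G] E_def)
  qed
  \<comment> \<open>Otherwise a copy of \<open>D\<close> that avoids the closed neighbourhoods of
    all \<open>f u\<close> would combine with \<open>f\<close> to a copy of
    \<open>H\<close>.\<close>
  have "E \<subseteq> (\<Union>u \<in> R. hit (f u))"
  proof
    fix ss assume ss: "ss \<in> E"
    then obtain g where g: "embeds D G g" "ss = map g (vlist D)"
      unfolding E_def exts_eq_embeds[OF D G] by auto
    show "ss \<in> (\<Union>u \<in> R. hit (f u))"
    proof (rule ccontr)
      assume "ss \<notin> (\<Union>u \<in> R. hit (f u))"
      then have "set ss \<inter> closed_nbhd G (f u) = {}" if "u \<in> R" for u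
        using ss that by (auto simp: hit_def)
      then have N: "g v \<notin> closed_nbhd G (f u)" if "u \<in> R" "v \<in> verts D" for u v
        using that g(2) set_vlist[OF D] by auto
      have gv: "g v \<in> verts G" if "v \<in> verts D" for v
        using that g(1) by (auto simp: embeds_def)
      have sep': "f u \<noteq> g v" "{f u, g v} \<notin> edges G" "{g v, f u} \<notin> edges G"
        if "u \<in> R" "v \<in> verts H - R" for u v
      proof -
        have "g v \<noteq> f u \<and> {f u, g v} \<notin> edges G"
          using N[of u v] gv[of v] that by (simp add: vD closed_nbhd_def)
        then show "f u \<noteq> g v" "{f u, g v} \<notin> edges G" "{g v, f u} \<notin> edges G"
          by (simp_all add: insert_commute eq_commute)
      qed
      have "embeds H G (\<lambda>u. if u \<in> R then f u else g u)"
        unfolding embeds_def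
      proof (intro conjI ballI)
        show "inj_on (\<lambda>u. if u \<in> R then f u else g u) (verts H)"
        proof (rule inj_onI)
          fix u v
          assume "u \<in> verts H" "v \<in> verts H"
            and "(if u \<in> R then f u else g u) = (if v \<in> R then f v else g v)"
          moreover have "inj_on f R" "inj_on g (verts H - R)"
            using f g(1) by (simp_all add: embeds_def vD)
          ultimately show "u = v"
            using sep'(1)[of u v] sep'(1)[of v u] by (auto dest: inj_onD split: if_splits)
        qed
        show "(\<lambda>u. if u \<in> R then f u else g u) ` verts H \<subseteq> verts G"
          using f g(1) unfolding embeds_def vD verts_induced by auto
      next
        fix u v assume "u \<in> verts H" "v \<in> verts H"
        then show "{u, v} \<in> edges H \<longleftrightarrow>
            {if u \<in> R then f u else g u, if v \<in> R then f v else g v} \<in> edges G"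
          using f g(1) sep'(2)[of u v] sep'(3)[of v u] sep[of u v] sep[of v u]
          unfolding embeds_def vD verts_induced D_def delete_def
          by (cases "u \<in> R"; cases "v \<in> R") (simp_all add: insert_commute)
      qed
      with free show False
        by (auto simp: is_free_iff)
    qed
  qed
  moreover have "finite (\<Union>u \<in> R. hit (f u))"
    by (rule finite_subset[OF _ finE]) (auto simp: hit_def)
  ultimately have "card E \<le> card (\<Union>u \<in> R. hit (f u))"
    by (intro card_mono)
  moreover have finR: "finite R"
    using R finite_verts[OF H] finite_subset by blast
  ultimately have cardE: "card E \<le> (\<Sum>u \<in> R. card (hit (f u)))"
    using card_UN_le[OF finR, of "\<lambda>u. hit (f u)"] by linarith
  have E: "card E > 0"
    using pos by (simp add: E_def num_emb_def D_def)
  \<comment> \<open>By \<open>cardE\<close>, the average of \<open>card (hit (f u))\<close> over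
    \<open>R\<close> is at least \<open>card E / card R\<close>.\<close>
  have "\<exists>u \<in> R. card E \<le> card R * card (hit (f u))"
  proof (rule ccontr)
    assume "\<not> ?thesis"
    then have "card R * card (hit (f u)) < card E" if "u \<in> R" for u
      using that by auto
    moreover have "R \<noteq> {}"
      using cardE E by auto
    ultimately have "(\<Sum>u \<in> R. card R * card (hit (f u))) < (\<Sum>u \<in> R. card E)"
      using finR by (intro sum_strict_mono) auto
    then have "card R * (\<Sum>u \<in> R. card (hit (f u))) < card R * card E"
      by (simp add: sum_distrib_left)
    then show False
      using cardE by simp
  qed
  then obtain u where u: "u \<in> R" "card E \<le> card R * card (hit (f u))"
    by blast
  then have "card R * mu (f u) + card E \<le> card R * card E"
    using mu[of "f u", symmetric] by (simp add: distrib_left)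
  moreover have "f u \<in> verts G"
    using f u(1) by (auto simp: embeds_def)
  ultimately show ?thesis
    unfolding mu_def E_def num_emb_def D_def by blast
qed

section \<open>Maximum weight independent sets\<close>

lemma finite_independent_weights:
  "simple_graph G \<Longrightarrow> finite {(\<Sum>v \<in> I. w v) | I. independent G I}"
  by (rule finite_subset[of _ "(\<lambda>I. \<Sum>v \<in> I. w v) ` Pow (verts G)"])
    (auto simp: independent_def finite_verts)

lemma mwis_ge: "simple_graph G \<Longrightarrow> independent G I \<Longrightarrow> (\<Sum>v \<in> I. w v) \<le> mwis G w"
  unfolding mwis_def by (rule Max_ge[OF finite_independent_weights]) auto

lemma mwis_attained:
  assumes "simple_graph G"
  obtains I where "independent G I" "mwis G w = (\<Sum>v \<in> I. w v)"
proof -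
  have "independent G {}"
    by (simp add: independent_def)
  then have "mwis G w \<in> {(\<Sum>v \<in> I. w v) | I. independent G I}"
    unfolding mwis_def by (intro Max_in finite_independent_weights assms) auto
  then show ?thesis
    using that by blast
qed

lemma mwis_empty: "simple_graph G \<Longrightarrow> verts G = {} \<Longrightarrow> mwis G w = 0"
  by (rule mwis_attained[of G w]) (auto simp: independent_def)

lemma independent_delete_iff:
  "independent (delete G D) I \<longleftrightarrow> independent G I \<and> I \<inter> D = {}"
  by (auto simp: independent_def delete_def)

text \<open>As \<open>x\<close> is arbitrary here, the choice made by \<open>BEST\<close> affects
  the time and never the value.\<close>

lemma mwis_branch:
  assumes G: "simple_graph G" and x: "x \<in> verts G"
  shows "mwis G w = max (mwis (delete G {x}) w) (w x + mwis (delete G (closed_nbhd G x)) w)"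
proof (rule antisym)
  obtain I where I: "independent G I" "mwis G w = (\<Sum>v \<in> I. w v)"
    by (rule mwis_attained[OF G])
  show "mwis G w \<le> max (mwis (delete G {x}) w) (w x + mwis (delete G (closed_nbhd G x)) w)"
  proof (cases "x \<in> I")
    case True
    then have "independent (delete G (closed_nbhd G x)) (I - {x})"
      using I(1) unfolding independent_delete_iff by (auto simp: independent_def closed_nbhd_def)
    then have "(\<Sum>v \<in> I - {x}. w v) \<le> mwis (delete G (closed_nbhd G x)) w"
      by (rule mwis_ge[OF simple_graph_delete[OF G]])
    moreover have "finite I"
      using I(1) finite_verts[OF G] finite_subset by (auto simp: independent_def)
    ultimately show ?thesis
      using I(2) True by (simp add: sum.remove)
  next
    case False
    then have "independent (delete G {x}) I"
      using I(1) unfolding independent_delete_iff by simp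
    then show ?thesis
      using mwis_ge[OF simple_graph_delete[OF G]] I(2) by (simp add: le_max_iff_disj)
  qed
next
  have "mwis (delete G {x}) w \<le> mwis G w"
  proof -
    obtain I where "independent (delete G {x}) I" "mwis (delete G {x}) w = (\<Sum>v \<in> I. w v)"
      by (rule mwis_attained[OF simple_graph_delete[OF G]])
    then show ?thesis
      using mwis_ge[OF G] by (simp add: independent_delete_iff)
  qed
  moreover have "w x + mwis (delete G (closed_nbhd G x)) w \<le> mwis G w"
  proof -
    obtain I where I: "independent (delete G (closed_nbhd G x)) I"
      "mwis (delete G (closed_nbhd G x)) w = (\<Sum>v \<in> I. w v)"
      by (rule mwis_attained[OF simple_graph_delete[OF G]])
    have "independent G (insert x I)"
      using I(1)[unfolded independent_delete_iff] x not_edge_refl[OF G, of x]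
      by (auto simp: independent_def closed_nbhd_def insert_commute)
    moreover have "finite I" "x \<notin> I"
      using I(1)[unfolded independent_delete_iff] finite_verts[OF G] finite_subset
      by (auto simp: independent_def closed_nbhd_def)
    ultimately show ?thesis
      using mwis_ge[OF G, of "insert x I" w] I(2) by simp
  qed
  ultimately show "max (mwis (delete G {x}) w) (w x + mwis (delete G (closed_nbhd G x)) w) \<le> mwis G w"
    by simp
qed

section \<open>Connected components\<close>

text \<open>These sets are the unions of components. The recursion keeps cutting off one component,
  so the vertices that remain form such a set.\<close>

definition closed_in :: "'a graph \<Rightarrow> 'a set \<Rightarrow> bool" where
  "closed_in H R \<longleftrightarrow> R \<subseteq> verts H \<and> (\<forall>u \<in> R. \<forall>v. {u, v} \<in> edges H \<longrightarrow> v \<in> R)"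

definition component :: "'a graph \<Rightarrow> 'a \<Rightarrow> 'a set" where
  "component H v = {u. (v, u) \<in> (adj_rel H)\<^sup>*}"

lemma components_eq: "components H = (\<lambda>v. induced H (component H v)) ` verts H"
  by (auto simp: components_def component_def)

lemma edge_verts: "simple_graph H \<Longrightarrow> {u, v} \<in> edges H \<Longrightarrow> u \<in> verts H \<and> v \<in> verts H"
  by (auto simp: simple_graph_def)

lemma component_closed:
  assumes "simple_graph H" "v \<in> verts H"
  shows "closed_in H (component H v)"
proof -
  have "u \<in> verts H" if "(v, u) \<in> (adj_rel H)\<^sup>*" for u
    using that by induction (auto simp: assms adj_rel_def dest: edge_verts[OF assms(1)])
  then show ?thesis
    by (auto simp: closed_in_def component_def adj_rel_def intro: rtrancl_into_rtrancl)
qed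

lemma component_subset: "closed_in H R \<Longrightarrow> v \<in> R \<Longrightarrow> component H v \<subseteq> R"
proof
  fix u assume R: "closed_in H R" "v \<in> R" and "u \<in> component H v"
  then have "(v, u) \<in> (adj_rel H)\<^sup>*"
    by (simp add: component_def)
  then show "u \<in> R"
    by induction (use R in \<open>auto simp: closed_in_def adj_rel_def\<close>)
qed

lemma closed_in_Compl:
  assumes "simple_graph H" "closed_in H R"
  shows "closed_in H (verts H - R)"
  unfolding closed_in_def
proof (intro conjI ballI allI impI)
  fix u v assume "u \<in> verts H - R" "{u, v} \<in> edges H"
  then show "v \<in> verts H - R"
    using assms edge_verts[OF assms(1), of u v] by (auto simp: closed_in_def insert_commute)
qed auto

lemma component_induced:
  assumes R: "closed_in H R" and v: "v \<in> R"
  shows "component (induced H R) v = component H v"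
proof
  have "adj_rel (induced H R) \<subseteq> adj_rel H"
    by (auto simp: adj_rel_def)
  then show "component (induced H R) v \<subseteq> component H v"
    unfolding component_def using rtrancl_mono by blast
  show "component H v \<subseteq> component (induced H R) v"
  proof
    fix u assume "u \<in> component H v"
    then have "(v, u) \<in> (adj_rel H)\<^sup>*"
      by (simp add: component_def)
    then have "u \<in> R \<and> (v, u) \<in> (adj_rel (induced H R))\<^sup>*"
    proof induction
      case (step y z)
      then have "z \<in> R" "(y, z) \<in> adj_rel (induced H R)"
        using R by (auto simp: closed_in_def adj_rel_def)
      with step show ?case
        by (auto intro: rtrancl_into_rtrancl)
    qed (use v in simp)
    then show "u \<in> component (induced H R) v"
      by (simp add: component_def)
  qed
qed

text \<open>Keeps the recursion on \<open>rest H\<close> within the oracles that belong to the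
  components of the input pattern.\<close>

lemma components_induced:
  assumes R: "closed_in H R"
  shows "components (induced H R) \<subseteq> components H"
proof -
  have "induced (induced H R) (component (induced H R) v) = induced H (component H v)" if "v \<in> R" for v
    unfolding component_induced[OF R that]
    using component_subset[OF R that] by (auto simp: induced_def)
  then show ?thesis
    using R unfolding components_eq closed_in_def by auto
qed

lemma set_expand:
  "simple_graph H \<Longrightarrow> set (expand H R) = {u \<in> verts H. \<exists>v \<in> set R. v = u \<or> {u, v} \<in> edges H \<and> v \<in> verts H}"
  by (auto simp: expand_def set_vlist set_nbrs)

text \<open>The sets reached grow strictly until they are stable, and a stable set is closed under
  adjacency; having at most \<open>card (verts H)\<close> elements, they are stable after that many
  rounds.\<close>

lemma set_reach:
  assumes H: "simple_graph H" and v: "v \<in> verts H"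
  shows "set ((expand H ^^ card (verts H)) [v]) = component H v"
proof -
  define S where "S i = set ((expand H ^^ i) [v])" for i
  have S0: "S 0 = {v}"
    by (simp add: S_def)
  have SSuc: "S (Suc i) = {u \<in> verts H. \<exists>v \<in> S i. v = u \<or> {u, v} \<in> edges H \<and> v \<in> verts H}" for i
    unfolding S_def by (simp add: set_expand[OF H])
  have sub: "S i \<subseteq> verts H" for i
    by (cases i) (use v in \<open>auto simp: S0 SSuc\<close>)
  have mono: "S i \<subseteq> S (Suc i)" for i
    using sub[of i] unfolding SSuc by blast
  have comp: "S i \<subseteq> component H v" for i
  proof (induction i)
    case 0
    show ?case
      by (simp add: S0 component_def)
  next
    case (Suc i)
    then show ?case
      using component_closed[OF H v] unfolding SSuc closed_in_def by (auto simp: insert_commute)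
  qed
  \<comment> \<open>Growth starts from one element, so i strict steps give more than i elements; for
    i = \<open>card (verts H)\<close> only stability is left.\<close>
  have grow: "S (Suc i) = S i \<or> i < card (S i)" for i
  proof (induction i)
    case 0
    show ?case
      by (simp add: S0)
  next
    case (Suc i)
    show ?case
    proof (cases "S (Suc i) = S i")
      case True
      then show ?thesis
        by (simp add: SSuc[of "Suc i"] SSuc[of i])
    next
      case False
      then have "card (S i) < card (S (Suc i))"
        using mono[of i] sub[of "Suc i"] finite_verts[OF H] finite_subset
        by (intro psubset_card_mono) auto
      with False Suc show ?thesis
        by simp
    qed
  qed
  have "\<not> card (verts H) < card (S (card (verts H)))"
    using card_mono[OF finite_verts[OF H] sub] by (simp add: not_less)
  with grow have stable: "S (Suc (card (verts H))) = S (card (verts H))"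
    by blast
  have "v \<in> S i" for i
    by (induction i) (use mono S0 in auto)
  moreover have "closed_in H (S (card (verts H)))"
    unfolding closed_in_def
  proof (intro conjI ballI allI impI sub)
    fix u u' assume "u \<in> S (card (verts H))" "{u, u'} \<in> edges H"
    then have "u' \<in> S (Suc (card (verts H)))"
      unfolding SSuc using edge_verts[OF H, of u u'] by (auto simp: insert_commute)
    then show "u' \<in> S (card (verts H))"
      by (simp add: stable)
  qed
  ultimately have "component H v \<subseteq> S (card (verts H))"
    by (intro component_subset)
  with comp show ?thesis
    unfolding S_def by blast
qed

text \<open>No edge leaves \<open>R\<close>, so entries are copied with their neighbour lists
  unchanged. This is why \<open>KEEP\<close> and \<open>DROP\<close>, unlike \<open>DELETE\<close>,
  do not filter neighbours.\<close>

lemma enc_graph_induced: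
  assumes H: "simple_graph H" and R: "closed_in H R"
  shows "enc_list (map (hent H) (filter (\<lambda>u. u \<in> R) (vlist H))) = enc_graph (induced H R)"
proof -
  have "filter (\<lambda>u. u \<in> R) (vlist H) = vlist (induced H R)"
    using R unfolding vlist_def filter_sorted_list_of_set[OF finite_verts[OF H]] closed_in_def
    by (auto intro!: arg_cong[where f = sorted_list_of_set])
  moreover have "hent H u = hent (induced H R) u" if "u \<in> set (vlist (induced H R))" for u
  proof -
    have "simple_graph (induced H R)"
      using R by (intro simple_graph_induced H) (simp add: closed_in_def)
    then have "u \<in> R"
      using that set_vlist by fastforce
    then have "{v \<in> verts H. {u, v} \<in> edges H} = {v \<in> verts (induced H R). {u, v} \<in> edges (induced H R)}"
      using R by (auto simp: closed_in_def)
    then show ?thesis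
      by (simp add: hent_def nbrs_def)
  qed
  ultimately show ?thesis
    unfolding enc_graph_eq by (simp cong: map_cong)
qed

text \<open>The program searches from the head of the encoded list, so the component of the least
  vertex is the one cut off.\<close>

definition first_part :: "nat graph \<Rightarrow> nat set" where
  "first_part H = component H (hd (vlist H))"

definition rest :: "nat graph \<Rightarrow> nat graph" where
  "rest H = delete H (first_part H)"

lemma first_part:
  assumes H: "simple_graph H" and "verts H \<noteq> {}"
  shows "hd (vlist H) \<in> verts H" "closed_in H (first_part H)" "hd (vlist H) \<in> first_part H"
    "induced H (first_part H) \<in> components H" "components (rest H) \<subseteq> components H"
    "card (first_part H) + card (verts (rest H)) = card (verts H)" "0 < card (first_part H)"
proof -
  have "vlist H \<noteq> []"
    using assms set_vlist[OF H] by (metis set_empty)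
  then show hd: "hd (vlist H) \<in> verts H"
    using set_vlist[OF H] hd_in_set by blast
  then show closed: "closed_in H (first_part H)"
    unfolding first_part_def by (rule component_closed[OF H])
  show mem: "hd (vlist H) \<in> first_part H"
    by (simp add: first_part_def component_def)
  show "induced H (first_part H) \<in> components H"
    using hd by (auto simp: components_eq first_part_def)
  show "components (rest H) \<subseteq> components H"
    unfolding rest_def delete_def by (rule components_induced[OF closed_in_Compl[OF H closed]])
  have sub: "first_part H \<subseteq> verts H"
    using closed by (simp add: closed_in_def)
  then show "0 < card (first_part H)"
    using mem finite_verts[OF H] by (auto simp: card_gt_0_iff intro: finite_subset)
  show "card (first_part H) + card (verts (rest H)) = card (verts H)"
    using sub finite_verts[OF H] card_mono[OF finite_verts[OF H] sub]
    by (simp add: rest_def delete_def card_Diff_subset finite_subset)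
qed

section \<open>The recursion\<close>

text \<open>The work of one call of \<open>SOLVE\<close> without the recursive calls, in this order:
  \<open>REACH\<close>, \<open>KEEP\<close> with \<open>DROP\<close>, the two embedding tests,
  \<open>BEST\<close>, the two deletions in \<open>BRANCH\<close>, and the operations in
  between.\<close>

definition node_cost :: "nat \<Rightarrow> nat \<Rightarrow> nat" where
  "node_cost h n = 220 * (h + 1) ^ 4 + 120 * (h + 1) ^ 2 + 2 * emb_cost h n + best_cost h n * (n + 1)
     + 800 * (n + 1) ^ 3 + 300"

text \<open>\<open>SOLVE\<close> and \<open>BRANCH\<close> call each other; the two calls of
  \<open>SOLVE\<close> enter as assumptions that the induction in \<open>computes_SOLVE\<close>
  discharges.\<close>

lemma computes_BRANCH:
  assumes G: "simple_graph G" and x: "x \<in> verts G" and n: "card (verts G) \<le> n"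
    and del: "computes Q B SOLVE [H, enc_wgraph (delete G {x}) w] (Num (mwis (delete G {x}) w)) T1"
    and nbhd: "computes Q B SOLVE [H, enc_wgraph (delete G (closed_nbhd G x)) w]
      (Num (mwis (delete G (closed_nbhd G x)) w)) T2"
  shows "computes Q B BRANCH [H, enc_wgraph G w, gent G w x] (Num (mwis G w))
    (T1 + T2 + 800 * (n + 1) ^ 3 + 60)"
proof -
  define c where "c = 400 * (n + 1) ^ 3"
  have c: "400 * (card (verts G) + 1) ^ 3 \<le> c"
    unfolding c_def using n by (intro mult_le_mono power_mono) auto
  note d1 = computes_mono[OF computes_DELETE_vertex[OF G] c]
  note d2 = computes_mono[OF computes_DELETE_nbhd[OF G] c]
  have "computes Q B BRANCH [H, enc_wgraph G w, gent G w x] (Num (mwis G w)) (T1 + T2 + 2 * c + 60)"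
    unfolding computes_body branch_body_def mwis_branch[OF G x]
    by (auto simp: gent_def intro!: fun_wpI[OF d1] fun_wpI[OF d2] fun_wpI[OF del] fun_wpI[OF nbhd])
  then show ?thesis
    by (simp add: c_def)
qed

text \<open>\<open>budget H G s\<close>: taking a vertex into the solution \<open>s\<close> times, each time leaving at most a
  \<open>(1 - 1/a)\<close>-fraction of the copies of \<open>rest H\<close>, destroys all of them.\<close>

definition budget :: "nat graph \<Rightarrow> nat graph \<Rightarrow> nat \<Rightarrow> bool" where
  "budget H G s \<longleftrightarrow>
     num_emb (rest H) G * (card (first_part H) - 1) ^ s < card (first_part H) ^ s"

text \<open>Bernoulli's inequality (1 + 1/c)^k >= 1 + k/c, cleared of fractions; for k = c + 1 its
  right-hand side exceeds 2. With c = a - 1 it says that (1 - 1/a)^a is at most 1/2.\<close>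

lemma two_mult_power_le: "2 * c ^ (c + 1) \<le> (c + 1) ^ (c + 1)" for c :: nat
proof (cases "c = 0")
  case False
  have *: "c ^ k * (c + k) \<le> (c + 1) ^ k * c" for k
  proof (induction k)
    case (Suc k)
    have "c ^ Suc k * (c + Suc k) \<le> (c + 1) * (c ^ k * (c + k))"
      by (simp add: algebra_simps)
    also have "\<dots> \<le> (c + 1) * ((c + 1) ^ k * c)"
      by (rule mult_le_mono2[OF Suc])
    finally show ?case
      by (simp add: mult_ac)
  qed simp
  have "c * (2 * c ^ (c + 1)) \<le> c ^ (c + 1) * (c + (c + 1))"
    by (simp add: algebra_simps)
  also have "\<dots> \<le> (c + 1) ^ (c + 1) * c"
    by (rule *)
  finally have "c * (2 * c ^ (c + 1)) \<le> c * (c + 1) ^ (c + 1)"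
    by (simp only: mult.commute)
  with False show ?thesis
    by (simp only: mult_le_cancel1)
qed simp

text \<open>Taking a = \<open>card (first_part H)\<close> vertices at least halves the number of
  copies. With d = \<open>card (verts (rest H))\<close> there are at most 2^(b d) copies, so (d + 1)
  b halvings leave less than one; the additional b makes the inequality strict.\<close>

lemma budget_start:
  assumes H: "simple_graph H" "verts H \<noteq> {}" and G: "simple_graph G"
    and b: "card (verts G) < 2 ^ b" "0 < b"
  shows "budget H G (card (first_part H) * ((card (verts (rest H)) + 1) * b))"
proof -
  define d where "d = card (verts (rest H))"
  define a where "a = card (first_part H)"
  define e where "e = (d + 1) * b"
  have a: "0 < a"
    using first_part(7)[OF H] by (simp add: a_def)
  have e: "0 < e"
    using b by (simp add: e_def)
  have "num_emb (rest H) G \<le> card (verts G) ^ d"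
    unfolding d_def rest_def by (rule num_emb_le[OF simple_graph_delete[OF H(1)] G])
  also have "\<dots> \<le> (2 ^ b) ^ d"
    using b by (intro power_mono) auto
  also have "\<dots> < 2 ^ e"
    using b(2) by (simp add: e_def flip: power_mult)
  finally have emb: "num_emb (rest H) G < 2 ^ e" .
  show ?thesis
  proof (cases "a = 1")
    \<comment> \<open>Here a - 1 = 0, and its power vanishes because the exponent is
      positive.\<close>
    case True
    then show ?thesis
      using e by (simp add: budget_def a_def[symmetric] e_def d_def)
  next
    case False
    then have "num_emb (rest H) G * (a - 1) ^ (a * e) < 2 ^ e * (a - 1) ^ (a * e)"
      using emb a by (intro mult_strict_right_mono) auto
    also have "\<dots> = (2 * (a - 1) ^ a) ^ e"
      by (simp add: power_mult power_mult_distrib)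
    also have "\<dots> \<le> (a ^ a) ^ e"
      using two_mult_power_le[of "a - 1"] a by (intro power_mono) auto
    finally show ?thesis
      by (simp add: budget_def a_def e_def d_def power_mult)
  qed
qed

lemma budget_mono: "budget H G s \<Longrightarrow> num_emb (rest H) G' \<le> num_emb (rest H) G \<Longrightarrow> budget H G' s"
  unfolding budget_def by (meson le_less_trans mult_le_mono1)

text \<open>With N and N' copies before and after, the last assumption reads a N' <= (a - 1) N,
  which uses up one factor (a - 1)/a. A budget of 0 would force N = 0, so a unit is always left to
  spend.\<close>

lemma budget_step:
  assumes s: "budget H G s" and pos: "num_emb (rest H) G > 0" and a: "card (first_part H) > 0"
    and le: "card (first_part H) * num_emb (rest H) G' + num_emb (rest H) G
      \<le> card (first_part H) * num_emb (rest H) G"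
  obtains s' where "s = Suc s'" "budget H G' s'"
proof -
  define a where "a = card (first_part H)"
  obtain s' where s': "s = Suc s'"
    using s pos by (cases s) (auto simp: budget_def)
  have "a * num_emb (rest H) G' \<le> (a - 1) * num_emb (rest H) G"
    using le by (simp add: a_def diff_mult_distrib)
  then have "a * num_emb (rest H) G' * (a - 1) ^ s' \<le> (a - 1) * num_emb (rest H) G * (a - 1) ^ s'"
    by (rule mult_le_mono1)
  then have "a * (num_emb (rest H) G' * (a - 1) ^ s') \<le> num_emb (rest H) G * (a - 1) ^ s"
    by (simp add: s' mult_ac)
  also have "\<dots> < a * a ^ s'"
    using s by (simp add: budget_def a_def s')
  finally have "budget H G' s'"
    by (simp add: budget_def a_def)
  with s' show ?thesis
    using that by blast
qed

text \<open>The reserve \<open>card (verts (rest H)) * k\<close> is spent once the pattern shrinks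
  to \<open>rest H\<close>, and the factor \<open>card (verts H) + 1\<close> pays for these
  shrinkings. The final + 1 keeps the exponent positive after a vertex is taken, as
  \<open>branching_recurrence\<close> demands.\<close>

definition solve_bound :: "nat \<Rightarrow> nat graph \<Rightarrow> nat graph \<Rightarrow> nat \<Rightarrow> nat \<Rightarrow> nat" where
  "solve_bound k H G s K =
     K * ((card (verts H) + 1) * (card (verts G) + 1) ^ (s + card (verts (rest H)) * k + 1))"

text \<open>The two powers add up to (m + 1) m^p. For p > 0 this stays below (m + 1)^(p + 1) by at
  least m + 1, and that gap pays for \<open>K\<close>.\<close>

lemma branching_recurrence:
  fixes m p K h :: nat
  assumes "0 < m" "0 < p" "m1 < m" "m2 < m"
    and T1: "T1 \<le> K * ((h + 1) * (m1 + 1) ^ (p + 1))"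
    and T2: "T2 \<le> K * ((h + 1) * (m2 + 1) ^ p)"
  shows "K + T1 + T2 \<le> K * ((h + 1) * (m + 1) ^ (p + 1))"
proof -
  have "T1 \<le> K * ((h + 1) * m ^ (p + 1))"
    using assms by (intro order_trans[OF T1] mult_le_mono power_mono) auto
  moreover have "T2 \<le> K * ((h + 1) * m ^ p)"
    using assms by (intro order_trans[OF T2] mult_le_mono power_mono) auto
  moreover have "1 + (h + 1) * m ^ (p + 1) + (h + 1) * m ^ p \<le> (h + 1) * (m + 1) ^ (p + 1)"
  proof -
    have "m ^ p < (m + 1) ^ p"
      using assms by (intro power_strict_mono) auto
    then have "(m + 1) * (m ^ p + 1) \<le> (m + 1) * (m + 1) ^ p"
      by (intro mult_le_mono2) simp
    then have "(h + 1) * ((m + 1) * m ^ p + 1) \<le> (h + 1) * (m + 1) ^ (p + 1)"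
      by (intro mult_le_mono2) simp
    then show ?thesis
      by (simp add: algebra_simps)
  qed
  then have "K * (1 + (h + 1) * m ^ (p + 1) + (h + 1) * m ^ p) \<le> K * ((h + 1) * (m + 1) ^ (p + 1))"
    by (rule mult_le_mono2)
  ultimately show ?thesis
    by (simp only: distrib_left mult_1_right)
qed

text \<open>The value is unconditional, the cost is not. \<open>h\<close> and \<open>n\<close> bound
  the sizes of the input, which makes the node cost uniform over the recursion. Every recursive call
  shrinks the pattern or the graph; the graph remains an induced subgraph of \<open>G0\<close>, so
  that queries stay in \<open>B\<close>.\<close>

lemma computes_SOLVE:
  fixes H0 G0 :: "nat graph"
  assumes Q: "\<And>F. F \<in> components H0 \<Longrightarrow> solves_mwis_free F (Q (enc_graph F))"
    and B: "\<And>F S. F \<in> components H0 \<Longrightarrow> S \<subseteq> verts G0 \<Longrightarrow> is_free F (induced G0 S) \<Longrightarrow>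
      (enc_graph F, enc_wgraph (induced G0 S) w) \<in> B"
    and h: "card (verts H) \<le> h" and n: "card (verts G) \<le> n" "n < 2 ^ b" "0 < b"
    and H: "simple_graph H" "components H \<subseteq> components H0"
    and G: "simple_graph G" "verts G \<subseteq> verts G0" "G = induced G0 (verts G)"
  shows "\<exists>T. computes Q B SOLVE [enc_graph H, enc_wgraph G w] (Num (mwis G w)) T \<and>
    (\<forall>s. is_free H G \<and> budget H G s \<longrightarrow> T \<le> solve_bound (h * b) H G s (node_cost h n))"
  using h n H G
proof (induction "card (verts H) + card (verts G)" arbitrary: H G rule: less_induct)
  case (less H G)
  note h = less.prems(1) and n = less.prems(2) and b = less.prems(3,4)
    and H = less.prems(5) and compH = less.prems(6) and G = less.prems(7) and G0 = less.prems(8,9)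
  define K where "K = node_cost h n"
  have K_le: "K \<le> solve_bound (h * b) H G s K" for H G s
  proof -
    have "K * (1 * 1) \<le> solve_bound (h * b) H G s K"
      unfolding solve_bound_def by (intro mult_le_mono one_le_power) auto
    then show ?thesis
      by simp
  qed
  have G_delete: "verts (delete G D) \<subseteq> verts G0" "delete G D = induced G0 (verts (delete G D))" for D
  proof -
    show "verts (delete G D) \<subseteq> verts G0"
      using G0(1) by (auto simp: delete_def)
    have "edges G = {e \<in> edges G0. e \<subseteq> verts G}"
      using arg_cong[OF G0(2), of edges] by simp
    then show "delete G D = induced G0 (verts (delete G D))"
      by (auto simp: delete_def induced_def)
  qed
  \<comment> \<open>\<open>T\<close> already contains the 800 * (n + 1) ^ 3 + 60 operations of
    \<open>BRANCH\<close>; the rest of \<open>K\<close> is left for the work done before it is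
    called.\<close>
  have branch: "\<exists>T. computes Q B BRANCH [enc_graph H, enc_wgraph G w, gent G w x] (Num (mwis G w)) T \<and>
      (\<forall>s s'. is_free H G \<and> budget H G s \<and> s = Suc s' \<and> budget H (delete G (closed_nbhd G x)) s' \<longrightarrow>
        T + (K - 800 * (n + 1) ^ 3 - 60) \<le> solve_bound (h * b) H G s K)"
    if x: "x \<in> verts G" for x
  proof -
    have lt: "card (verts (delete G D)) < card (verts G)" if "x \<in> D" for D
      using x that finite_verts[OF G] unfolding delete_def verts_induced
      by (intro psubset_card_mono) auto
    have IH: "\<exists>T. computes Q B SOLVE [enc_graph H, enc_wgraph (delete G D) w] (Num (mwis (delete G D) w)) T \<and>
        (\<forall>s. is_free H (delete G D) \<and> budget H (delete G D) s \<longrightarrow>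
          T \<le> solve_bound (h * b) H (delete G D) s K)" if "x \<in> D" for D
      unfolding K_def
    proof (rule less.hyps[OF _ h _ b H compH simple_graph_delete[OF G] G_delete])
      show "card (verts H) + card (verts (delete G D)) < card (verts H) + card (verts G)"
        "card (verts (delete G D)) \<le> n"
        using lt[OF that] n by simp_all
    qed
    obtain T1 where T1: "computes Q B SOLVE [enc_graph H, enc_wgraph (delete G {x}) w]
        (Num (mwis (delete G {x}) w)) T1"
      "\<And>s. is_free H (delete G {x}) \<Longrightarrow> budget H (delete G {x}) s \<Longrightarrow>
        T1 \<le> solve_bound (h * b) H (delete G {x}) s K"
      using IH[of "{x}"] by blast
    have x_nbhd: "x \<in> closed_nbhd G x"
      by (simp add: closed_nbhd_def)
    obtain T2 where T2: "computes Q B SOLVE [enc_graph H, enc_wgraph (delete G (closed_nbhd G x)) w]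
        (Num (mwis (delete G (closed_nbhd G x)) w)) T2"
      "\<And>s. is_free H (delete G (closed_nbhd G x)) \<Longrightarrow> budget H (delete G (closed_nbhd G x)) s \<Longrightarrow>
        T2 \<le> solve_bound (h * b) H (delete G (closed_nbhd G x)) s K"
      using IH[OF x_nbhd] by blast
    have "T1 + T2 + 800 * (n + 1) ^ 3 + 60 + (K - 800 * (n + 1) ^ 3 - 60) \<le> solve_bound (h * b) H G s K"
      if free: "is_free H G" and s: "budget H G s" "s = Suc s'" "budget H (delete G (closed_nbhd G x)) s'"
      for s s'
    proof -
      have "budget H (delete G {x}) s"
        by (rule budget_mono[OF s(1)]) (simp add: rest_def num_emb_delete_le simple_graph_delete H G)
      then have "T1 \<le> solve_bound (h * b) H (delete G {x}) s K"
        by (intro T1(2) is_free_delete free)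
      moreover have "T2 \<le> solve_bound (h * b) H (delete G (closed_nbhd G x)) s' K"
        by (intro T2(2) is_free_delete free s)
      ultimately have "K + T1 + T2 \<le> solve_bound (h * b) H G s K"
        unfolding solve_bound_def s(2)
        using lt[of "{x}"] lt[OF x_nbhd]
        by (intro branching_recurrence[where ?m1.0 = "card (verts (delete G {x}))"
              and ?m2.0 = "card (verts (delete G (closed_nbhd G x)))"]) auto
      moreover have "800 * (n + 1) ^ 3 + 60 \<le> K"
        unfolding K_def node_cost_def by linarith
      ultimately show ?thesis
        by linarith
    qed
    with computes_BRANCH[OF G x n T1(1) T2(1)] show ?thesis
      by blast
  qed
  show ?case
  proof (cases "verts G = {}")
    case True
    have "computes Q B SOLVE [enc_graph H, enc_wgraph G w] (Num (mwis G w)) K"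
      using True by (simp add: computes_body solve_body_def enc_wgraph_eq vlist_def mwis_empty[OF G]
          K_def node_cost_def)
    then show ?thesis
      using K_le unfolding K_def by blast
  next
    case nonempty: False
    then have vG: "vlist G \<noteq> []"
      using set_vlist[OF G] by (metis set_empty)
    then obtain y ys where ys: "vlist G = y # ys"
      by (cases "vlist G") auto
    obtain e where encG: "enc_wgraph G w = Node (gent G w y) e"
      by (simp add: enc_wgraph_eq ys)
    show ?thesis
    proof (cases "verts H = {}")
      case True
      have "y \<in> verts G"
        using set_vlist[OF G] ys by auto
      then obtain T where T: "computes Q B BRANCH [enc_graph H, enc_wgraph G w, gent G w y] (Num (mwis G w)) T"
        using branch by blast
      have encH: "enc_graph H = Num 0"
        using True by (simp add: enc_graph_eq vlist_def)
      have "computes Q B SOLVE [enc_graph H, enc_wgraph G w] (Num (mwis G w)) (T + 50)"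
        using T unfolding computes_body(1) solve_body_def encH encG
        by (auto intro!: fun_wpI)
      \<comment> \<open>The empty pattern embeds by any function, so the cost clause is
        vacuous.\<close>
      moreover have "\<not> is_free H G"
        using True by (simp add: is_free_iff embeds_def)
      ultimately show ?thesis
        by blast
    next
      case False
      note fp = first_part[OF H False]
      define C where "C = induced H (first_part H)"
      define D where "D = rest H"
      obtain z zs where zs: "vlist H = z # zs"
        using set_vlist[OF H] False by (cases "vlist H") auto
      obtain e' where encH: "enc_graph H = Node (Node (Num z) (nums (nbrs H z))) e'"
        by (simp add: enc_graph_eq zs hent_def)
      define R where "R = (expand H ^^ card (verts H)) [z]"
      have z: "z \<in> verts H" "hd (vlist H) = z"
        using fp(1) zs by simp_all
      have setR: "set R = first_part H"
        unfolding R_def first_part_def z(2) by (rule set_reach[OF H z(1)])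
      have "0 < card (verts H)"
        using False finite_verts[OF H] by (simp add: card_gt_0_iff)
      then have lenR: "length R \<le> h" "1 \<le> h"
        using h length_expand[of H] unfolding R_def
        by (cases "card (verts H)"; force intro: order_trans)+
      define r where "r = 220 * (h + 1) ^ 4"
      define kd where "kd = 60 * (h + 1) ^ 2"
      define ec where "ec = emb_cost h n"
      define bc where "bc = best_cost h n * (n + 1)"
      have K: "K = r + 2 * kd + 2 * ec + bc + 800 * (n + 1) ^ 3 + 300"
        by (simp add: K_def node_cost_def r_def kd_def ec_def bc_def)
      have reach: "computes Q B REACH [enc_graph H, enc_graph H, Node (Num z) (Num 0)] (nums R) r"
        using computes_REACH[OF H h, of "[z]"] lenR by (simp add: R_def r_def)
      have simpC: "simple_graph C" and simpD: "simple_graph D"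
        unfolding C_def D_def rest_def using fp(2)
        by (auto simp: closed_in_def intro!: simple_graph_induced simple_graph_delete H)
      have keep: "computes Q B KEEP [enc_graph H, nums R] (enc_graph C) kd"
        using computes_KEEP_DROP(1)[OF lenR(1) h]
        unfolding setR enc_graph_induced[OF H fp(2)] C_def kd_def .
      have "filter (\<lambda>u. u \<notin> first_part H) (vlist H) = filter (\<lambda>u. u \<in> verts H - first_part H) (vlist H)"
        by (rule filter_cong) (auto simp: set_vlist[OF H])
      then have "enc_list (map (hent H) (filter (\<lambda>u. u \<notin> first_part H) (vlist H))) = enc_graph D"
        using enc_graph_induced[OF H closed_in_Compl[OF H fp(2)]] by (simp add: D_def rest_def delete_def)
      then have drop: "computes Q B DROP [enc_graph H, nums R] (enc_graph D) kd"
        using computes_KEEP_DROP(2)[OF lenR(1) h] unfolding setR kd_def by metis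
      have cardC: "card (verts C) \<le> h" and cardD: "card (verts D) \<le> h" "card (verts D) < card (verts H)"
        using fp(6,7) h by (simp_all add: C_def D_def)
      have countC: "computes Q B COUNT [enc_graph C, Num 0, enc_wgraph G w, enc_wgraph G w]
          (Num (num_emb C G)) ec"
        unfolding ec_def by (rule computes_COUNT[OF G simpC cardC n])
      have countD: "computes Q B COUNT [enc_graph D, Num 0, enc_wgraph G w, enc_wgraph G w]
          (Num (num_emb D G)) ec"
        unfolding ec_def by (rule computes_COUNT[OF G simpD cardD(1) n])
      have caseG: "(case enc_wgraph G w of Num k \<Rightarrow> f k | Node x y \<Rightarrow> g x y) = g (gent G w y) e"
        and caseH: "(case enc_graph H of Num k \<Rightarrow> f k | Node x y \<Rightarrow> g x y) =
          g (Node (Num z) (nums (nbrs H z))) e'" for f :: "nat \<Rightarrow> bool" and g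
        by (simp_all add: encG encH)
      \<comment> \<open>r + 2 * kd + 100 accounts for splitting the pattern, so that only
        \<open>dispatch_body\<close> remains to be run.\<close>
      have step: "computes Q B SOLVE [enc_graph H, enc_wgraph G w] v T'"
        if "wp Q B [enc_graph D, enc_graph C, nums R, enc_graph H, enc_wgraph G w] dispatch_body
          (\<lambda>v' t. v' = v \<and> t + (r + 2 * kd + 100) \<le> T')" for v T'
        unfolding computes_body solve_body_def
        by (auto simp: caseG caseH intro!: fun_wpI[OF reach] fun_wpI[OF keep] fun_wpI[OF drop] wp_mono[OF that])
      consider (query) "num_emb C G = 0" | (rest) "num_emb C G > 0" "num_emb D G = 0"
        | (branch) "num_emb C G > 0" "num_emb D G > 0"
        by auto
      then show ?thesis
      proof cases
        case query
        then have free: "is_free C G"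
          using num_emb_eq_0_iff[OF simpC G] by simp
        have "C \<in> components H0"
          using fp(4) compH by (auto simp: C_def)
        moreover have "Q (enc_graph C) (enc_wgraph G w) = mwis G w"
          using Q[OF \<open>C \<in> components H0\<close>] free G by (simp add: solves_mwis_free_def)
        moreover have "(enc_graph C, enc_wgraph G w) \<in> B"
          using B[OF \<open>C \<in> components H0\<close> G0(1)] free G0(2) by simp
        ultimately have "computes Q B SOLVE [enc_graph H, enc_wgraph G w] (Num (mwis G w)) K"
          by (intro step) (auto simp: dispatch_body_def K query intro!: fun_wpI[OF countC])
        then show ?thesis
          using K_le unfolding K_def by blast
      next
        case rest
        have compD: "components D \<subseteq> components H0"
          using fp(5) compH by (auto simp: D_def)
        have "\<exists>T. computes Q B SOLVE [enc_graph D, enc_wgraph G w] (Num (mwis G w)) T \<and>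
          (\<forall>s. is_free D G \<and> budget D G s \<longrightarrow> T \<le> solve_bound (h * b) D G s K)"
          unfolding K_def
          by (rule less.hyps[OF _ cardD(1) n b simpD compD G G0]) (use cardD(2) in simp)
        then obtain T where T: "computes Q B SOLVE [enc_graph D, enc_wgraph G w] (Num (mwis G w)) T"
          "\<And>s. is_free D G \<Longrightarrow> budget D G s \<Longrightarrow> T \<le> solve_bound (h * b) D G s K"
          by blast
        have "computes Q B SOLVE [enc_graph H, enc_wgraph G w] (Num (mwis G w)) (T + K)"
          using rest by (intro step)
            (auto simp: dispatch_body_def K intro!: fun_wpI[OF countC] fun_wpI[OF countD] fun_wpI[OF T(1)])
        moreover have "T + K \<le> solve_bound (h * b) H G s K" for s
        proof -
          have freeD: "is_free D G"
            using num_emb_eq_0_iff[OF simpD G] rest by simp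
          \<comment> \<open>An empty \<open>D\<close> would have the empty embedding.\<close>
          then have neD: "verts D \<noteq> {}"
            by (auto simp: is_free_iff embeds_def)
          note fpD = first_part[OF simpD neD]
          \<comment> \<open>A fresh budget for the first part of \<open>D\<close>. As
            \<open>card (verts (rest D)) + 1 \<le> h\<close>, it fits together with its own reserve
            into the reserve \<open>card (verts D) * (h * b)\<close> of \<open>H\<close>, whatever
            \<open>s\<close> is.\<close>
          define s' where "s' = card (first_part D) * ((card (verts (rest D)) + 1) * b)"
          have "T \<le> solve_bound (h * b) D G s' K"
            unfolding s'_def using n b by (intro T(2) freeD budget_start simpD neD G) auto
          also have "\<dots> \<le> K * (card (verts H) * (card (verts G) + 1) ^ (s + card (verts D) * (h * b) + 1))"
          proof -
            have "card (verts (rest D)) + 1 \<le> h"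
              using fpD(6,7) cardD by simp
            then have "s' \<le> card (first_part D) * (h * b)"
              unfolding s'_def by (intro mult_le_mono) auto
            then have "s' + card (verts (rest D)) * (h * b) \<le> card (verts D) * (h * b)"
              unfolding fpD(6)[symmetric] by (simp add: distrib_right)
            then show ?thesis
              unfolding solve_bound_def using cardD(2)
              by (intro mult_le_mono power_increasing) auto
          qed
          finally have T_le: "T
              \<le> K * (card (verts H) * (card (verts G) + 1) ^ (s + card (verts D) * (h * b) + 1))" .
          have "K * 1 \<le> K * (card (verts G) + 1) ^ (s + card (verts D) * (h * b) + 1)"
            by (intro mult_le_mono one_le_power) auto
          with T_le show ?thesis
            unfolding solve_bound_def D_def[symmetric]
            by (simp only: distrib_right distrib_left mult_1_left mult_1_right)
        qed
        ultimately show ?thesis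
          unfolding K_def[symmetric] by (intro exI[of _ "T + K"] conjI allI impI)
      next
        case branch': branch
        obtain x c where x: "x \<in> verts G"
          and best: "computes Q B BEST [enc_graph D, enc_wgraph G w, enc_wgraph G w] (Node c (gent G w x)) bc"
          and min: "\<And>y. y \<in> verts G \<Longrightarrow>
            num_emb D (delete G (closed_nbhd G x)) \<le> num_emb D (delete G (closed_nbhd G y))"
          using computes_BEST[OF G simpD cardD(1) n nonempty] unfolding bc_def by blast
        obtain T where T: "computes Q B BRANCH [enc_graph H, enc_wgraph G w, gent G w x] (Num (mwis G w)) T"
          "\<And>s s'. is_free H G \<Longrightarrow> budget H G s \<Longrightarrow> s = Suc s' \<Longrightarrow> budget H (delete G (closed_nbhd G x)) s' \<Longrightarrow>
            T + (K - 800 * (n + 1) ^ 3 - 60) \<le> solve_bound (h * b) H G s K"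
          using branch[OF x] by blast
        have "computes Q B SOLVE [enc_graph H, enc_wgraph G w] (Num (mwis G w))
            (T + (K - 800 * (n + 1) ^ 3 - 60))"
          using branch' by (intro step)
            (auto simp: dispatch_body_def K intro!: fun_wpI[OF countC] fun_wpI[OF countD]
              fun_wpI[OF best] fun_wpI[OF T(1)])
        moreover have "T + (K - 800 * (n + 1) ^ 3 - 60) \<le> solve_bound (h * b) H G s K"
          if free: "is_free H G" and s: "budget H G s" for s
        proof -
          have "\<not> is_free C G"
            using branch' num_emb_eq_0_iff[OF simpC G] by simp
          then obtain y where y: "y \<in> verts G"
            "card (first_part H) * num_emb D (delete G (closed_nbhd G y)) + num_emb D G
              \<le> card (first_part H) * num_emb D G"
            using exists_vertex_hitting[OF H G free, of "first_part H"] branch' fp(2)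
            unfolding C_def D_def rest_def closed_in_def by blast
          \<comment> \<open>\<open>x\<close> minimises the number of surviving copies and so
            inherits the bound that averaging gives for \<open>y\<close>.\<close>
          have "card (first_part H) * num_emb D (delete G (closed_nbhd G x)) + num_emb D G
              \<le> card (first_part H) * num_emb D G"
            using mult_le_mono2[OF min[OF y(1)], of "card (first_part H)"] y(2) by linarith
          then obtain s' where "s = Suc s'" "budget H (delete G (closed_nbhd G x)) s'"
            using budget_step[OF s _ fp(7)] branch' unfolding D_def by blast
          then show ?thesis
            by (intro T(2) free s)
        qed
        ultimately show ?thesis
          unfolding K_def[symmetric]
          by (intro exI[of _ "T + (K - 800 * (n + 1) ^ 3 - 60)"] conjI allI impI) blast+
      qed
    qed
  qed
qed

section \<open>The running time\<close>

text \<open>Bounding every summand by a multiple of one product \<open>Z\<close> gives 2540 * Z;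
  4096 = 2^12 is the next power of two, which turns into n^12 for n >= 2.\<close>

lemma node_cost_le: "node_cost h n \<le> 4096 * ((h + 1) ^ 4 * (n + 2) ^ (h + 4))"
proof -
  define Z where "Z = (h + 1) ^ 4 * (n + 2) ^ (h + 4)"
  have le: "(h + 1) ^ i * (n + 2) ^ j \<le> Z" if "i \<le> 4" "j \<le> h + 4" for i j
    unfolding Z_def using that by (intro mult_le_mono power_increasing) auto
  have emb: "emb_cost h n * (n + 2) ^ i \<le> 200 * Z" if "i \<le> 2" for i
  proof -
    have "h + n + 1 \<le> (h + 1) * (n + 1)"
      by simp
    then have "emb_cost h n \<le> 200 * ((h + 1) * (n + 2)) * (h + 1) * (n + 2) * (n + 2) ^ h"
      unfolding emb_cost_def count_cost_def by (intro mult_le_mono) auto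
    also have "\<dots> = 200 * ((h + 1) ^ 2 * (n + 2) ^ (h + 2))"
      by (simp only: power_add power2_eq_square mult_ac)
    finally have "emb_cost h n * (n + 2) ^ i \<le> 200 * ((h + 1) ^ 2 * (n + 2) ^ (h + 2)) * (n + 2) ^ i"
      by (rule mult_le_mono1)
    also have "\<dots> = 200 * ((h + 1) ^ 2 * (n + 2) ^ (h + 2 + i))"
      by (simp only: power_add mult_ac)
    also have "\<dots> \<le> 200 * Z"
      using that by (intro mult_le_mono2 le) auto
    finally show ?thesis .
  qed
  have n_pow: "(n + 1) ^ j \<le> Z" if "j \<le> 4" for j
  proof -
    have "(n + 1) ^ j \<le> (n + 2) ^ j"
      by (intro power_mono) auto
    also have "\<dots> \<le> Z"
      using le[of 0 j] that by simp
    finally show ?thesis .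
  qed
  have n1: "n + 1 \<le> Z" and one: "1 \<le> Z"
    using n_pow[of 1] n_pow[of 0] by simp_all
  have h4: "(h + 1) ^ 4 \<le> Z" and h2: "(h + 1) ^ 2 \<le> Z"
    using le[of 4 0] le[of 2 0] by simp_all
  have "emb_cost h n * (n + 1) \<le> emb_cost h n * (n + 2) ^ 1"
    by simp
  then have emb_n: "emb_cost h n * (n + 1) \<le> 200 * Z"
    using emb[of 1] by linarith
  have p4: "x ^ 4 = x ^ 3 * x" for x :: nat
    by (simp add: numeral_eq_Suc mult_ac)
  have "best_cost h n * (n + 1) = 400 * (n + 1) ^ 4 + emb_cost h n * (n + 1) + 100 * (n + 1)"
    unfolding best_cost_def p4 by (simp only: distrib_right mult.assoc)
  also have "\<dots> \<le> 400 * Z + 200 * Z + 100 * Z"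
    using emb_n n_pow[of 4] n1 by (intro add_mono mult_le_mono2) auto
  finally have "best_cost h n * (n + 1) \<le> 700 * Z"
    by simp
  moreover have "emb_cost h n \<le> 200 * Z"
    using emb[of 0] by simp
  ultimately show ?thesis
    using n_pow[of 3] h4 h2 one unfolding node_cost_def Z_def[symmetric] by linarith
qed

text \<open>For n >= 2 all factors lie below powers of n, namely h + 1 below n^h and n + 1, n + 2
  below n^2, which reduces the claim to comparing exponents.\<close>

lemma solve_bound_le:
  fixes h n b s k :: nat
  assumes n: "2 \<le> n" "card (verts G) = n" and h: "card (verts H) = h"
    and b: "real b \<le> 2 * log 2 (real n)"
    and s: "s + card (verts (rest H)) * (h * b) \<le> h * (h * b)" and pos: "1 \<le> h" "1 \<le> k"
  shows "real (solve_bound (h * b) H G s (node_cost h n))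
    \<le> real n powr (33 * real h ^ 2 * real k * log 2 (real n) ^ 3)"
proof -
  define L where "L = log 2 (real n)"
  have L: "1 \<le> L"
    unfolding L_def using n by simp
  have "2 * n \<le> n ^ 2"
    using mult_le_mono1[OF n(1), of n] by (simp only: power2_eq_square)
  then have n2: "n + 2 \<le> n ^ 2" "n + 1 \<le> n ^ 2"
    using n(1) by linarith+
  have "h + 1 \<le> 2 ^ h"
    by (induction h) auto
  also have "\<dots> \<le> n ^ h"
    using n by (intro power_mono) auto
  finally have hn: "h + 1 \<le> n ^ h" .
  have "(4096 :: nat) = 2 ^ 12"
    by simp
  also have "\<dots> \<le> n ^ 12"
    using n by (intro power_mono) auto
  finally have const: "4096 \<le> n ^ 12" .
  have "node_cost h n \<le> 4096 * ((h + 1) ^ 4 * (n + 2) ^ (h + 4))"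
    by (rule node_cost_le)
  also have "\<dots> \<le> n ^ 12 * ((n ^ h) ^ 4 * (n ^ 2) ^ (h + 4))"
    using const hn n2 by (intro mult_le_mono power_mono) auto
  finally have "node_cost h n * ((h + 1) * (n + 1) ^ (s + card (verts (rest H)) * (h * b) + 1))
      \<le> n ^ 12 * ((n ^ h) ^ 4 * (n ^ 2) ^ (h + 4)) * (n ^ h * (n ^ 2) ^ (h * (h * b) + 1))"
  proof (intro mult_le_mono hn)
    have "(n + 1) ^ (s + card (verts (rest H)) * (h * b) + 1) \<le> (n + 1) ^ (h * (h * b) + 1)"
      using s by (intro power_increasing) auto
    also have "\<dots> \<le> (n ^ 2) ^ (h * (h * b) + 1)"
      using n2 by (intro power_mono) auto
    finally show "(n + 1) ^ (s + card (verts (rest H)) * (h * b) + 1) \<le> (n ^ 2) ^ (h * (h * b) + 1)" .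
  qed
  also have "\<dots> = n ^ (12 + (h * 4 + 2 * (h + 4)) + (h + 2 * (h * (h * b) + 1)))"
    by (simp only: power_add power_mult)
  also have "12 + (h * 4 + 2 * (h + 4)) + (h + 2 * (h * (h * b) + 1)) = 22 + 7 * h + 2 * (h * (h * b))"
    by simp
  finally have "solve_bound (h * b) H G s (node_cost h n) \<le> n ^ (22 + 7 * h + 2 * (h * (h * b)))"
    by (simp only: solve_bound_def n h)
  then have "real (solve_bound (h * b) H G s (node_cost h n)) \<le> real (n ^ (22 + 7 * h + 2 * (h * (h * b))))"
    by (simp only: of_nat_le_iff)
  also have "\<dots> = real n powr real (22 + 7 * h + 2 * (h * (h * b)))"
    using n by (simp only: of_nat_power powr_realpow)
  also have "\<dots> \<le> real n powr (33 * real h ^ 2 * real k * L ^ 3)"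
  proof (rule powr_mono)
    define X where "X = real h ^ 2 * L"
    have hX: "real h \<le> real h ^ 2"
      using pos by (simp add: power2_eq_square)
    have "real h ^ 2 * 1 \<le> X"
      unfolding X_def using L by (intro mult_left_mono) auto
    then have "real h \<le> X" "1 \<le> X"
      using hX pos by linarith+
    moreover have "real h ^ 2 * real b \<le> 2 * X"
      using mult_left_mono[OF b, of "real h ^ 2"] by (simp add: X_def L_def)
    \<comment> \<open>33 = 22 + 7 + 2 * 2, from 1 <= X, h <= X and h^2 b <= 2 X.\<close>
    ultimately have "real (22 + 7 * h + 2 * (h * (h * b))) \<le> 33 * X"
      by (simp add: power2_eq_square)
    \<comment> \<open>The exponent so far has a single logarithm and no factor k; L and k are at
      least 1, so it lies below the stated one.\<close>
    also have "\<dots> \<le> 33 * (real h ^ 2 * (real k * L ^ 3))"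
    proof -
      have "L * 1 \<le> L ^ 3 * real k"
        using L pos self_le_power[of L 3] by (intro mult_mono) auto
      then show ?thesis
        unfolding X_def by (intro mult_left_mono) (auto simp: mult.commute)
    qed
    finally show "real (22 + 7 * h + 2 * (h * (h * b))) \<le> 33 * real h ^ 2 * real k * L ^ 3"
      by (simp add: mult_ac)
    show "1 \<le> real n"
      using n by simp
  qed
  finally show ?thesis
    unfolding L_def .
qed

lemma run_prog:
  fixes H G :: "nat graph"
  assumes H: "simple_graph H" and G: "simple_graph G"
    and Q: "\<forall>F \<in> components H. solves_mwis_free F (Q (enc_graph F))"
  shows "\<exists>t qs. run_program Q prog [enc_graph H, enc_wgraph G w] (Num (mwis G w)) t qs \<and>
    (\<forall>q \<in> qs. \<exists>F \<in> components H. \<exists>S \<subseteq> verts G. \<exists>w'.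
      is_free F (induced G S) \<and> q = (enc_graph F, enc_wgraph (induced G S) w')) \<and>
    (is_free H G \<and> card (verts G) \<ge> 2 \<longrightarrow>
      real t \<le> real (card (verts G)) powr
        (33 * real (card (verts H)) ^ 2 * real (card (components H)) * log 2 (real (card (verts G))) ^ 3))"
proof -
  define n where "n = card (verts G)"
  define h where "h = card (verts H)"
  \<comment> \<open>For n > 0 this is the bit length of n; for n >= 2 it is at most twice the
    logarithm.\<close>
  define b where "b = nat \<lfloor>log 2 (real n)\<rfloor> + 1"
  \<comment> \<open>Deleting vertices leaves the weights alone, so every query carries the original
    \<open>w\<close>.\<close>
  define B where "B = {(enc_graph F, enc_wgraph (induced G S) w) | F S.
    F \<in> components H \<and> S \<subseteq> verts G \<and> is_free F (induced G S)}"
  have nb: "n < 2 ^ b"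
  proof (cases "n = 0")
    case False
    then have "log 2 (real n) < real b"
      unfolding b_def by linarith
    then have "real n < 2 powr real b"
      using False by (simp add: log_less_iff)
    then show ?thesis
      by (simp add: powr_realpow)
  qed simp
  have G_eq: "G = induced G (verts G)"
    using G by (cases G) (auto simp: induced_def simple_graph_def)
  have b: "0 < b"
    by (simp add: b_def)
  have Q': "solves_mwis_free F (Q (enc_graph F))" if "F \<in> components H" for F
    using Q that by blast
  have B: "(enc_graph F, enc_wgraph (induced G S) w) \<in> B"
    if "F \<in> components H" "S \<subseteq> verts G" "is_free F (induced G S)" for F S
    using that unfolding B_def by blast
  obtain T where T: "computes Q B SOLVE [enc_graph H, enc_wgraph G w] (Num (mwis G w)) T"
    and bound: "\<And>s. is_free H G \<Longrightarrow> budget H G s \<Longrightarrow> T \<le> solve_bound (h * b) H G s (node_cost h n)"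
    using computes_SOLVE[OF Q' B eq_refl[OF h_def[symmetric]] eq_refl[OF n_def[symmetric]] nb b
        H subset_refl G subset_refl G_eq] by blast
  from T obtain t qs where run: "runs Q prog [enc_graph H, enc_wgraph G w] (prog ! SOLVE) (Num (mwis G w)) t qs"
    "t \<le> T" "qs \<subseteq> B"
    unfolding computes_def fun_wp_def wp_def by blast
  have "run_program Q prog [enc_graph H, enc_wgraph G w] (Num (mwis G w)) t qs"
    using run(1) by (simp add: run_program_def SOLVE_def prog_def)
  moreover have "\<forall>q \<in> qs. \<exists>F \<in> components H. \<exists>S \<subseteq> verts G. \<exists>w'.
      is_free F (induced G S) \<and> q = (enc_graph F, enc_wgraph (induced G S) w')"
  proof
    fix q assume "q \<in> qs"
    then obtain F S where "F \<in> components H" "S \<subseteq> verts G" "is_free F (induced G S)"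
      "q = (enc_graph F, enc_wgraph (induced G S) w)"
      using subsetD[OF run(3)] unfolding B_def by blast
    then show "\<exists>F \<in> components H. \<exists>S \<subseteq> verts G. \<exists>w'.
        is_free F (induced G S) \<and> q = (enc_graph F, enc_wgraph (induced G S) w')"
      by blast
  qed
  moreover have "real t \<le> real n powr (33 * real h ^ 2 * real (card (components H)) * log 2 (real n) ^ 3)"
    if free: "is_free H G" and n: "n \<ge> 2"
  proof -
    have nonempty: "verts H \<noteq> {}"
      using free by (auto simp: is_free_iff embeds_def)
    note fp = first_part[OF H nonempty]
    have h: "1 \<le> h"
      using fp(6,7) by (simp add: h_def)
    have "finite (components H)" "components H \<noteq> {}"
      using finite_verts[OF H] nonempty by (simp_all add: components_eq)
    then have k: "1 \<le> card (components H)"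
      by (simp add: Suc_le_eq card_gt_0_iff)
    define s where "s = card (first_part H) * ((card (verts (rest H)) + 1) * b)"
    have "budget H G s"
      unfolding s_def using nb by (intro budget_start H nonempty G) (auto simp: n_def b_def)
    then have "t \<le> solve_bound (h * b) H G s (node_cost h n)"
      using bound[OF free] run(2) by (meson order_trans)
    then have "real t \<le> real (solve_bound (h * b) H G s (node_cost h n))"
      by (simp only: of_nat_le_iff)
    also have "\<dots> \<le> real n powr (33 * real h ^ 2 * real (card (components H)) * log 2 (real n) ^ 3)"
    proof (rule solve_bound_le[OF n])
      have "card (verts (rest H)) + 1 \<le> h"
        using fp(6,7) by (simp add: h_def)
      then have "s \<le> card (first_part H) * (h * b)"
        unfolding s_def by (intro mult_le_mono) auto
      then show "s + card (verts (rest H)) * (h * b) \<le> h * (h * b)"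
        using fp(6) unfolding h_def[symmetric] by (metis add_le_mono1 distrib_right)
      have "1 \<le> log 2 (real n)"
        using n by simp
      then show "real b \<le> 2 * log 2 (real n)"
        unfolding b_def by linarith
    qed (use h k in \<open>simp_all add: n_def h_def\<close>)
    finally show ?thesis .
  qed
  ultimately show ?thesis
    unfolding n_def h_def by (intro exI[of _ t] exI[of _ qs] conjI impI) blast+
qed

theorem theorem2:
  shows "\<exists>(P :: program) (c :: real). c > 0 \<and>
    (\<forall>(H :: nat graph) (G :: nat graph) (w :: nat \<Rightarrow> nat) (Q :: val \<Rightarrow> val \<Rightarrow> nat).
      simple_graph H \<and> simple_graph G \<and>
      (\<forall>F \<in> components H. solves_mwis_free F (Q (enc_graph F))) \<longrightarrow>
      (\<exists>(t :: nat) qs.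
        run_program Q P [enc_graph H, enc_wgraph G w] (Num (mwis G w)) t qs \<and>
        (\<forall>q \<in> qs. \<exists>F \<in> components H. \<exists>S \<subseteq> verts G. \<exists>w'.
           is_free F (induced G S) \<and> q = (enc_graph F, enc_wgraph (induced G S) w')) \<and>
        (is_free H G \<and> card (verts G) \<ge> 2 \<longrightarrow>
           real t \<le> real (card (verts G)) powr
             (c * real (card (verts H)) ^ 2 * real (card (components H))
                * log 2 (real (card (verts G))) ^ 3))))"
proof (rule exI[of _ prog], rule exI[of _ "33 :: real"], intro conjI allI impI, goal_cases)
  case 1
  show ?case
    by simp
next
  case (2 H G w Q)
  then show ?case
    by (elim conjE) (rule run_prog)
qed

end
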